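(* Let $\widetilde{M}$ be an oriented connected $m$-dimensional Riemannian manifold with Levi-Civita connection $\widetilde{\nabla}$, endowed with an anti-torqued vector field $V$ with conformal scalar $\rho$. Let $\gamma:I\to\widetilde{M}$ be a Frenet curve of order $r$, $1\le r\le m$, parametrized by arc-length $s\in I$, with Frenet frame $(T^\gamma,N_2^\gamma,\dots,N_m^\gamma)$ and curvatures $\kappa_1,\dots,\kappa_{m-1}$. If $\gamma$ is an anti-torqued slant helix with axis $V$, i.e. $\langle V|_{\gamma(s)},N_2^\gamma(s)\rangle=\cos\theta$ for all $s\in I$ with a constant $\theta\in[0,2\pi]$, then one of the following holds: (a) $\gamma$ is a geodesic in $\widetilde{M}$; (b) $\gamma$ is a Frenet curve of order $2$, the conformal scalar of $V$ along $\gamma$ is the negative of the first curvature of $\gamma$ (that is, $\rho|_{\gamma}=-\kappa_1$), and $V$ is a concircular vector field along $\gamma$; (c) writing $V=f_1^\gamma T^\gamma+\cos\theta\,N_2^\gamma+\sum_{i=3}^m f_i^\gamma N_i^\gamma$ along $\gamma$, with smooth functions $f_1^\gamma,f_3^\gamma,\dots,f_m^\gamma$ on $I$, the following system is satisfied (with $\rho$ evaluated along $\gamma$): $$ \begin{aligned} &T^{\gamma}(f_{1}^{\gamma})-\cos\theta\,\kappa_{1}-\rho\,(1-(f_1^\gamma)^2)=0,\\ &\kappa_{1}f_{1}^{\gamma}-\kappa_{2}f_{3}^{\gamma}+\cos\theta\,\rho f_1^\gamma=0,\\ &T^{\gamma}(f_{3}^{\gamma})+\cos\theta\,\kappa_{2}-\kappa_{3}f_{4}^{\gamma}+\rho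 f_1^\gamma f_3^\gamma=0,\\ &T^{\gamma}(f_{i}^{\gamma})+\kappa_{i-1}f_{i-1}^{\gamma}-\kappa_{i}f_{i+1}^{\gamma}+\rho f_1^\gamma f_i^\gamma=0,\quad 4\le i\le m-1,\\ &T^{\gamma}(f_{m}^{\gamma})+\kappa_{m-1}f_{m-1}^{\gamma}+\rho f_1^\gamma f_m^\gamma=0. \end{aligned} $$
   Context: Anti-torqued vector field: a unit vector field $V$ on $\widetilde{M}$ for which there is a smooth function $\rho$ on $\widetilde{M}$ (the conformal scalar) with $\widetilde{\nabla}_X V=\rho\,(X-\langle X,V\rangle V)$ for all vector fields $X$ on $\widetilde{M}$. Frenet curve of order $r$: a curve $\gamma$ with tangent field $T^\gamma$ such that $\{T^\gamma,\widetilde{\nabla}_{T^\gamma}T^\gamma,\dots,\widetilde{\nabla}_{T^\gamma}^{r-1}T^\gamma\}$ is linearly independent at every parameter value. Frenet frame and curvatures (arc-length parametrization): a positively oriented orthonormal frame $(T^\gamma=N_1^\gamma,N_2^\gamma,\dots,N_m^\gamma)$ along $\gamma$ and smooth functions $\kappa_1,\dots,\kappa_{m-1}$ on $I$ with $\widetilde{\nabla}_{T^\gamma}T^\gamma=\kappa_1N_2^\gamma$, $\widetilde{\nabla}_{T^\gamma}N_i^\gamma=-\kappa_{i-1}N_{i-1}^\gamma+\kappa_iN_{i+1}^\gamma$ for $2\le i\le m-1$, and $\widetilde{\nabla}_{T^\gamma}N_m^\gamma=-\kappa_{m-1}N_{m-1}^\gamma$. For order $m$ the frame is the usual one obtained from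 $(T^\gamma,\widetilde{\nabla}_{T^\gamma}T^\gamma,\dots,\widetilde{\nabla}_{T^\gamma}^{m-1}T^\gamma)$; for smaller order it is understood that $\gamma$ carries such a frame, where higher curvatures may vanish. $N_2^\gamma$ is the unit principal vector field. $\gamma$ is a geodesic if $\kappa_1\equiv0$. $V$ is a concircular vector field along $\gamma$ means $\widetilde{\nabla}_{T^\gamma}V=\rho T^\gamma$ along $\gamma$. $T^\gamma(f)$ denotes the derivative $df/ds$. Convention for small $m$ in the system: terms with nonexistent indices are omitted ($f_j^\gamma=0$ for $j>m$, $\kappa_j=0$ for $j\ge m$), and each component $f_i^\gamma$ contributes one equation; for $m=3$ the system consists of the first three equations with $\kappa_3f_4^\gamma=0$. *)

theory Defs
  imports "HOL-Analysis.Analysis"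
begin

section \<open>Smooth maps between Euclidean spaces\<close>

text \<open>
  Derivatives are taken within \<open>S\<close>.  The definition is meant for open sets and, when
  \<open>'b = real\<close>, for relatively open subsets of a nondegenerate interval; at an endpoint belonging
  to the interval the derivatives are one-sided.
\<close>

primrec Ck_on ::
  "nat \<Rightarrow> 'b::euclidean_space set \<Rightarrow> ('b \<Rightarrow> 'c::real_normed_vector) \<Rightarrow> bool" where
  "Ck_on 0 S f \<longleftrightarrow> continuous_on S f"
| "Ck_on (Suc k) S f \<longleftrightarrow>
     f differentiable_on S \<and> (\<forall>v. Ck_on k S (\<lambda>x. frechet_derivative f (at x within S) v))"

definition smooth_on ::
  "'b::euclidean_space set \<Rightarrow> ('b \<Rightarrow> 'c::real_normed_vector) \<Rightarrow> bool" where
  "smooth_on S f \<longleftrightarrow> (\<forall>k. Ck_on k S f)"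


section \<open>Smooth manifolds\<close>

text \<open>A chart is a pair of its domain and its coordinate map.\<close>

type_synonym ('a, 'e) chart = "'a set \<times> ('a \<Rightarrow> 'e)"

abbreviation cdom :: "('a, 'e) chart \<Rightarrow> 'a set" where
  "cdom c \<equiv> fst c"

abbreviation cmap :: "('a, 'e) chart \<Rightarrow> 'a \<Rightarrow> 'e" where
  "cmap c \<equiv> snd c"

abbreviation cinv :: "('a, 'e) chart \<Rightarrow> 'e \<Rightarrow> 'a" where
  "cinv c \<equiv> inv_into (cdom c) (cmap c)"

definition transition :: "('a, 'e) chart \<Rightarrow> ('a, 'e) chart \<Rightarrow> 'e \<Rightarrow> 'e" where
  "transition c d = cmap d \<circ> cinv c"

text \<open>
  The atlas \<open>A\<close> need not be maximal: whether something is smooth may be tested on the charts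
  of \<open>A\<close> alone.
\<close>

definition smooth_manifold ::
  "nat \<Rightarrow> 'a topology \<Rightarrow> ('a, 'e::euclidean_space) chart set \<Rightarrow> bool" where
  "smooth_manifold m M A \<longleftrightarrow>
     DIM('e) = m \<and> Hausdorff_space M \<and> second_countable M \<and>
     topspace M = (\<Union>c\<in>A. cdom c) \<and>
     (\<forall>c\<in>A. openin M (cdom c) \<and> open (cmap c ` cdom c) \<and>
        homeomorphic_map (subtopology M (cdom c)) (top_of_set (cmap c ` cdom c)) (cmap c)) \<and>
     (\<forall>c\<in>A. \<forall>d\<in>A. smooth_on (cmap c ` (cdom c \<inter> cdom d)) (transition c d))"

definition smooth_fun ::
  "('a, 'e::euclidean_space) chart set \<Rightarrow> 'a set \<Rightarrow> ('a \<Rightarrow> real) \<Rightarrow> bool" where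
  "smooth_fun A U f \<longleftrightarrow>
     (\<forall>c\<in>A. smooth_on (cmap c ` (U \<inter> cdom c)) (\<lambda>x. f (cinv c x)))"


section \<open>Tangent vectors and vector fields\<close>

text \<open>
  A tangent vector at \<open>p\<close> is given by its components in all charts of the atlas around \<open>p\<close>, which
  transform by the derivatives of the transition maps.  All remaining entries are zero, so that
  equality of tangent vectors is equality in HOL.
\<close>

datatype ('a, 'e) tvec = Tvec (tcoord: "('a, 'e) chart \<Rightarrow> 'e")

instantiation tvec :: (type, real_vector) real_vector
begin

definition "0 = Tvec (\<lambda>_. 0)"
definition "v + w = Tvec (\<lambda>c. tcoord v c + tcoord w c)"
definition "v - w = Tvec (\<lambda>c. tcoord v c - tcoord w c)"
definition "- v = Tvec (\<lambda>c. - tcoord v c)"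
definition "a *\<^sub>R v = Tvec (\<lambda>c. a *\<^sub>R tcoord v c)"

instance
  by standard
    (simp_all add: zero_tvec_def plus_tvec_def minus_tvec_def uminus_tvec_def scaleR_tvec_def
      algebra_simps)

end

definition tangent_space ::
  "('a, 'e::euclidean_space) chart set \<Rightarrow> 'a \<Rightarrow> ('a, 'e) tvec set" where
  "tangent_space A p =
     {v. (\<forall>c\<in>A. \<forall>d\<in>A. p \<in> cdom c \<longrightarrow> p \<in> cdom d \<longrightarrow>
            tcoord v d = frechet_derivative (transition c d) (at (cmap c p)) (tcoord v c)) \<and>
         (\<forall>c. \<not> (c \<in> A \<and> p \<in> cdom c) \<longrightarrow> tcoord v c = 0)}"

definition vector_field_on ::
  "('a, 'e::euclidean_space) chart set \<Rightarrow> 'a set \<Rightarrow> ('a \<Rightarrow> ('a, 'e) tvec) \<Rightarrow> bool" where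
  "vector_field_on A U Y \<longleftrightarrow>
     (\<forall>p\<in>U. Y p \<in> tangent_space A p) \<and>
     (\<forall>c\<in>A. smooth_on (cmap c ` (U \<inter> cdom c)) (\<lambda>x. tcoord (Y (cinv c x)) c))"

text \<open>
  The derivative of \<open>f\<close> at \<open>p\<close> in the direction of a tangent vector \<open>v\<close>, computed in a chart \<open>c\<close>
  around \<open>p\<close>; by the chain rule the value does not depend on \<open>c\<close>.
\<close>

definition dir_deriv ::
  "('a, 'e::euclidean_space) chart \<Rightarrow> 'a \<Rightarrow> ('a, 'e) tvec \<Rightarrow> ('a \<Rightarrow> real) \<Rightarrow> real" where
  "dir_deriv c p v f = frechet_derivative (\<lambda>x. f (cinv c x)) (at (cmap c p)) (tcoord v c)"

definition lie_bracket ::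
  "('a, 'e::euclidean_space) chart set \<Rightarrow> ('a \<Rightarrow> ('a, 'e) tvec) \<Rightarrow> ('a \<Rightarrow> ('a, 'e) tvec) \<Rightarrow>
     'a \<Rightarrow> ('a, 'e) tvec" where
  "lie_bracket A X Y p = Tvec (\<lambda>c.
     if c \<in> A \<and> p \<in> cdom c then
       frechet_derivative (\<lambda>x. tcoord (Y (cinv c x)) c) (at (cmap c p)) (tcoord (X p) c)
       - frechet_derivative (\<lambda>x. tcoord (X (cinv c x)) c) (at (cmap c p)) (tcoord (Y p) c)
     else 0)"

text \<open>The vector field on \<open>cdom c\<close> whose components in the chart \<open>c\<close> are constantly \<open>u\<close>.\<close>

definition coord_field ::
  "('a, 'e::euclidean_space) chart set \<Rightarrow> ('a, 'e) chart \<Rightarrow> 'e \<Rightarrow> 'a \<Rightarrow> ('a, 'e) tvec" where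
  "coord_field A c u p = Tvec (\<lambda>d.
     if d \<in> A \<and> p \<in> cdom c \<and> p \<in> cdom d
     then frechet_derivative (transition c d) (at (cmap c p)) u else 0)"


section \<open>Orientation, metric and Levi-Civita connection\<close>

text \<open>
  An orientation is represented by a nowhere vanishing smooth \<open>m\<close>-form; the arguments of the form
  at a point are the entries \<open>1, \<dots>, m\<close> of a family of tangent vectors.  A frame is positively
  oriented if the form is positive on it.
\<close>

definition orientation_form ::
  "nat \<Rightarrow> 'a topology \<Rightarrow> ('a, 'e::euclidean_space) chart set \<Rightarrow>
     ('a \<Rightarrow> (nat \<Rightarrow> ('a, 'e) tvec) \<Rightarrow> real) \<Rightarrow> bool" where
  "orientation_form m M A \<omega> \<longleftrightarrow>
     (\<forall>p\<in>topspace M.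
        (\<forall>v w. (\<forall>i\<in>{1..m}. v i = w i) \<longrightarrow> \<omega> p v = \<omega> p w) \<and>
        (\<forall>v. (\<forall>i\<in>{1..m}. v i \<in> tangent_space A p) \<longrightarrow>
           (\<forall>i\<in>{1..m}. \<forall>x\<in>tangent_space A p. \<forall>y\<in>tangent_space A p. \<forall>a.
              \<omega> p (v(i := x + y)) = \<omega> p (v(i := x)) + \<omega> p (v(i := y)) \<and>
              \<omega> p (v(i := a *\<^sub>R x)) = a * \<omega> p (v(i := x))) \<and>
           (\<forall>i\<in>{1..m}. \<forall>j\<in>{1..m}. i \<noteq> j \<longrightarrow> v i = v j \<longrightarrow> \<omega> p v = 0)) \<and>
        (\<exists>v. (\<forall>i\<in>{1..m}. v i \<in> tangent_space A p) \<and> \<omega> p v \<noteq> 0)) \<and>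
     (\<forall>U Y. openin M U \<longrightarrow> (\<forall>i\<in>{1..m}. vector_field_on A U (Y i)) \<longrightarrow>
        smooth_fun A U (\<lambda>p. \<omega> p (\<lambda>i. Y i p)))"

definition riemannian_metric ::
  "'a topology \<Rightarrow> ('a, 'e::euclidean_space) chart set \<Rightarrow>
     ('a \<Rightarrow> ('a, 'e) tvec \<Rightarrow> ('a, 'e) tvec \<Rightarrow> real) \<Rightarrow> bool" where
  "riemannian_metric M A g \<longleftrightarrow>
     (\<forall>p\<in>topspace M.
        (\<forall>u\<in>tangent_space A p. \<forall>v\<in>tangent_space A p. \<forall>w\<in>tangent_space A p. \<forall>a.
           g p u v = g p v u \<and>
           g p (u + v) w = g p u w + g p v w \<and>
           g p (a *\<^sub>R u) w = a * g p u w) \<and>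
        (\<forall>v\<in>tangent_space A p. v \<noteq> 0 \<longrightarrow> g p v v > 0)) \<and>
     (\<forall>U Y Z. openin M U \<longrightarrow> vector_field_on A U Y \<longrightarrow> vector_field_on A U Z \<longrightarrow>
        smooth_fun A U (\<lambda>p. g p (Y p) (Z p)))"

text \<open>
  A connection \<open>D X Y\<close> (that is, \<open>\<nabla>\<^sub>X Y\<close>) is taken together with its restrictions to
  open subsets: it acts on vector fields over every open set \<open>U\<close>, and on \<open>U\<close> the result depends
  only on the values of the two fields on \<open>U\<close>.  The values that the total functions \<open>X\<close>, \<open>Y\<close> take
  outside \<open>U\<close> are irrelevant.
\<close>

definition affine_connection ::
  "'a topology \<Rightarrow> ('a, 'e::euclidean_space) chart set \<Rightarrow>
     (('a \<Rightarrow> ('a, 'e) tvec) \<Rightarrow> ('a \<Rightarrow> ('a, 'e) tvec) \<Rightarrow> 'a \<Rightarrow> ('a, 'e) tvec) \<Rightarrow> bool" where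
  "affine_connection M A D \<longleftrightarrow>
     (\<forall>U X Y. openin M U \<longrightarrow> vector_field_on A U X \<longrightarrow> vector_field_on A U Y \<longrightarrow>
        vector_field_on A U (D X Y) \<and>
        (\<forall>X' Y'. (\<forall>p\<in>U. X' p = X p \<and> Y' p = Y p) \<longrightarrow> (\<forall>p\<in>U. D X' Y' p = D X Y p)) \<and>
        (\<forall>X'. vector_field_on A U X' \<longrightarrow>
           (\<forall>p\<in>U. D (\<lambda>q. X q + X' q) Y p = D X Y p + D X' Y p)) \<and>
        (\<forall>Y'. vector_field_on A U Y' \<longrightarrow>
           (\<forall>p\<in>U. D X (\<lambda>q. Y q + Y' q) p = D X Y p + D X Y' p)) \<and>
        (\<forall>f. smooth_fun A U f \<longrightarrow>
           (\<forall>p\<in>U. D (\<lambda>q. f q *\<^sub>R X q) Y p = f p *\<^sub>R D X Y p \<and>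
              (\<forall>c\<in>A. p \<in> cdom c \<longrightarrow>
                 D X (\<lambda>q. f q *\<^sub>R Y q) p = dir_deriv c p (X p) f *\<^sub>R Y p + f p *\<^sub>R D X Y p))))"

definition levi_civita ::
  "'a topology \<Rightarrow> ('a, 'e::euclidean_space) chart set \<Rightarrow>
     ('a \<Rightarrow> ('a, 'e) tvec \<Rightarrow> ('a, 'e) tvec \<Rightarrow> real) \<Rightarrow>
     (('a \<Rightarrow> ('a, 'e) tvec) \<Rightarrow> ('a \<Rightarrow> ('a, 'e) tvec) \<Rightarrow> 'a \<Rightarrow> ('a, 'e) tvec) \<Rightarrow> bool" where
  "levi_civita M A g D \<longleftrightarrow>
     affine_connection M A D \<and>
     (\<forall>U X Y. openin M U \<longrightarrow> vector_field_on A U X \<longrightarrow> vector_field_on A U Y \<longrightarrow>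
        (\<forall>p\<in>U. D X Y p - D Y X p = lie_bracket A X Y p)) \<and>
     (\<forall>U X Y Z. openin M U \<longrightarrow>
        vector_field_on A U X \<longrightarrow> vector_field_on A U Y \<longrightarrow> vector_field_on A U Z \<longrightarrow>
        (\<forall>p\<in>U. \<forall>c\<in>A. p \<in> cdom c \<longrightarrow>
           dir_deriv c p (X p) (\<lambda>q. g q (Y q) (Z q)) = g p (D X Y p) (Z p) + g p (Y p) (D X Z p)))"

definition anti_torqued ::
  "'a topology \<Rightarrow> ('a, 'e::euclidean_space) chart set \<Rightarrow>
     ('a \<Rightarrow> ('a, 'e) tvec \<Rightarrow> ('a, 'e) tvec \<Rightarrow> real) \<Rightarrow>
     (('a \<Rightarrow> ('a, 'e) tvec) \<Rightarrow> ('a \<Rightarrow> ('a, 'e) tvec) \<Rightarrow> 'a \<Rightarrow> ('a, 'e) tvec) \<Rightarrow>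
     ('a \<Rightarrow> ('a, 'e) tvec) \<Rightarrow> ('a \<Rightarrow> real) \<Rightarrow> bool" where
  "anti_torqued M A g D V \<rho> \<longleftrightarrow>
     vector_field_on A (topspace M) V \<and> smooth_fun A (topspace M) \<rho> \<and>
     (\<forall>p\<in>topspace M. g p (V p) (V p) = 1) \<and>
     (\<forall>X. vector_field_on A (topspace M) X \<longrightarrow>
        (\<forall>p\<in>topspace M. D X V p = \<rho> p *\<^sub>R (X p - g p (X p) (V p) *\<^sub>R V p)))"


section \<open>Curves\<close>

definition smooth_curve ::
  "'a topology \<Rightarrow> ('a, 'e::euclidean_space) chart set \<Rightarrow> real set \<Rightarrow> (real \<Rightarrow> 'a) \<Rightarrow> bool" where
  "smooth_curve M A I \<gamma> \<longleftrightarrow>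
     is_interval I \<and> interior I \<noteq> {} \<and>
     continuous_map (top_of_set I) M \<gamma> \<and>
     (\<forall>c\<in>A. smooth_on {s \<in> I. \<gamma> s \<in> cdom c} (\<lambda>s. cmap c (\<gamma> s)))"

definition smooth_field_along ::
  "('a, 'e::euclidean_space) chart set \<Rightarrow> real set \<Rightarrow> (real \<Rightarrow> 'a) \<Rightarrow>
     (real \<Rightarrow> ('a, 'e) tvec) \<Rightarrow> bool" where
  "smooth_field_along A I \<gamma> W \<longleftrightarrow>
     (\<forall>s\<in>I. W s \<in> tangent_space A (\<gamma> s)) \<and>
     (\<forall>c\<in>A. smooth_on {s \<in> I. \<gamma> s \<in> cdom c} (\<lambda>s. tcoord (W s) c))"

definition tangent_field ::
  "('a, 'e::euclidean_space) chart set \<Rightarrow> real set \<Rightarrow> (real \<Rightarrow> 'a) \<Rightarrow>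
     real \<Rightarrow> ('a, 'e) tvec" where
  "tangent_field A I \<gamma> s = Tvec (\<lambda>c.
     if c \<in> A \<and> \<gamma> s \<in> cdom c
     then vector_derivative (\<lambda>t. cmap c (\<gamma> t)) (at s within I) else 0)"

text \<open>
  The covariant derivative of a field \<open>W\<close> along \<open>\<gamma>\<close>, by the local formula
  \<open>(\<nabla>\<^sub>T W)\<^sup>k = (W\<^sup>k)' + \<Gamma>\<^sup>k\<^sub>i\<^sub>j T\<^sup>i W\<^sup>j\<close>.  The Christoffel map
  of \<open>D\<close> in the chart \<open>c\<close> is the map \<open>(u, v) \<mapsto> \<Gamma>\<^sup>k\<^sub>i\<^sub>j u\<^sup>i v\<^sup>j\<close>,
  obtained from \<open>D\<close> applied to coordinate fields.
\<close>

definition christoffel ::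
  "('a, 'e::euclidean_space) chart set \<Rightarrow>
     (('a \<Rightarrow> ('a, 'e) tvec) \<Rightarrow> ('a \<Rightarrow> ('a, 'e) tvec) \<Rightarrow> 'a \<Rightarrow> ('a, 'e) tvec) \<Rightarrow>
     ('a, 'e) chart \<Rightarrow> 'a \<Rightarrow> 'e \<Rightarrow> 'e \<Rightarrow> 'e" where
  "christoffel A D c p u v = tcoord (D (coord_field A c u) (coord_field A c v) p) c"

definition cov_deriv ::
  "('a, 'e::euclidean_space) chart set \<Rightarrow>
     (('a \<Rightarrow> ('a, 'e) tvec) \<Rightarrow> ('a \<Rightarrow> ('a, 'e) tvec) \<Rightarrow> 'a \<Rightarrow> ('a, 'e) tvec) \<Rightarrow>
     real set \<Rightarrow> (real \<Rightarrow> 'a) \<Rightarrow> (real \<Rightarrow> ('a, 'e) tvec) \<Rightarrow> real \<Rightarrow> ('a, 'e) tvec" where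
  "cov_deriv A D I \<gamma> W s = Tvec (\<lambda>c.
     if c \<in> A \<and> \<gamma> s \<in> cdom c then
       vector_derivative (\<lambda>t. tcoord (W t) c) (at s within I)
       + christoffel A D c (\<gamma> s) (tcoord (tangent_field A I \<gamma> s) c) (tcoord (W s) c)
     else 0)"

text \<open>\<open>\<nabla>\<^sub>T\<^sup>k T\<close> along \<open>\<gamma>\<close>.\<close>

definition iter_deriv ::
  "('a, 'e::euclidean_space) chart set \<Rightarrow>
     (('a \<Rightarrow> ('a, 'e) tvec) \<Rightarrow> ('a \<Rightarrow> ('a, 'e) tvec) \<Rightarrow> 'a \<Rightarrow> ('a, 'e) tvec) \<Rightarrow>
     real set \<Rightarrow> (real \<Rightarrow> 'a) \<Rightarrow> nat \<Rightarrow> real \<Rightarrow> ('a, 'e) tvec" where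
  "iter_deriv A D I \<gamma> k = (cov_deriv A D I \<gamma> ^^ k) (tangent_field A I \<gamma>)"

text \<open>
  Injectivity makes this the linear independence of the family of the first \<open>r\<close> derivatives
  rather than of the set of their values.
\<close>

definition frenet_curve ::
  "'a topology \<Rightarrow> ('a, 'e::euclidean_space) chart set \<Rightarrow>
     (('a \<Rightarrow> ('a, 'e) tvec) \<Rightarrow> ('a \<Rightarrow> ('a, 'e) tvec) \<Rightarrow> 'a \<Rightarrow> ('a, 'e) tvec) \<Rightarrow>
     real set \<Rightarrow> (real \<Rightarrow> 'a) \<Rightarrow> nat \<Rightarrow> bool" where
  "frenet_curve M A D I \<gamma> r \<longleftrightarrow>
     smooth_curve M A I \<gamma> \<and>
     (\<forall>s\<in>I. inj_on (\<lambda>k. iter_deriv A D I \<gamma> k s) {..<r} \<and>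
        independent ((\<lambda>k. iter_deriv A D I \<gamma> k s) ` {..<r}))"

definition arc_length_param ::
  "('a, 'e::euclidean_space) chart set \<Rightarrow> ('a \<Rightarrow> ('a, 'e) tvec \<Rightarrow> ('a, 'e) tvec \<Rightarrow> real) \<Rightarrow>
     real set \<Rightarrow> (real \<Rightarrow> 'a) \<Rightarrow> bool" where
  "arc_length_param A g I \<gamma> \<longleftrightarrow>
     (\<forall>s\<in>I. g (\<gamma> s) (tangent_field A I \<gamma> s) (tangent_field A I \<gamma> s) = 1)"

text \<open>
  The last conjunct concerns curves of order \<open>m\<close>: there \<open>N 1, \<dots>, N (m - 1)\<close> are the result of
  Gram--Schmidt orthonormalization, and \<open>N m\<close> completes them to a positively oriented orthonormal
  frame.
\<close>

definition frenet_frame ::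
  "nat \<Rightarrow> 'a topology \<Rightarrow> ('a, 'e::euclidean_space) chart set \<Rightarrow>
     ('a \<Rightarrow> (nat \<Rightarrow> ('a, 'e) tvec) \<Rightarrow> real) \<Rightarrow>
     ('a \<Rightarrow> ('a, 'e) tvec \<Rightarrow> ('a, 'e) tvec \<Rightarrow> real) \<Rightarrow>
     (('a \<Rightarrow> ('a, 'e) tvec) \<Rightarrow> ('a \<Rightarrow> ('a, 'e) tvec) \<Rightarrow> 'a \<Rightarrow> ('a, 'e) tvec) \<Rightarrow>
     real set \<Rightarrow> (real \<Rightarrow> 'a) \<Rightarrow> (nat \<Rightarrow> real \<Rightarrow> ('a, 'e) tvec) \<Rightarrow>
     (nat \<Rightarrow> real \<Rightarrow> real) \<Rightarrow> bool" where
  "frenet_frame m M A \<omega> g D I \<gamma> N \<kappa> \<longleftrightarrow>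
     (\<forall>i\<in>{1..m}. smooth_field_along A I \<gamma> (N i)) \<and>
     (\<forall>i\<in>{1..<m}. smooth_on I (\<kappa> i)) \<and>
     (\<forall>s\<in>I. N 1 s = tangent_field A I \<gamma> s) \<and>
     (\<forall>s\<in>I. \<forall>i\<in>{1..m}. \<forall>j\<in>{1..m}. g (\<gamma> s) (N i s) (N j s) = (if i = j then 1 else 0)) \<and>
     (\<forall>s\<in>I. \<omega> (\<gamma> s) (\<lambda>i. N i s) > 0) \<and>
     (2 \<le> m \<longrightarrow> (\<forall>s\<in>I. cov_deriv A D I \<gamma> (N 1) s = \<kappa> 1 s *\<^sub>R N 2 s)) \<and>
     (\<forall>i. 2 \<le> i \<and> i \<le> m - 1 \<longrightarrow>
        (\<forall>s\<in>I. cov_deriv A D I \<gamma> (N i) s =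
           - \<kappa> (i - 1) s *\<^sub>R N (i - 1) s + \<kappa> i s *\<^sub>R N (i + 1) s)) \<and>
     (2 \<le> m \<longrightarrow> (\<forall>s\<in>I. cov_deriv A D I \<gamma> (N m) s = - \<kappa> (m - 1) s *\<^sub>R N (m - 1) s)) \<and>
     (frenet_curve M A D I \<gamma> m \<longrightarrow>
        (\<forall>i\<in>{1..<m}. \<forall>s\<in>I.
           let v = iter_deriv A D I \<gamma> (i - 1) s;
               w = v - (\<Sum>j=1..<i. g (\<gamma> s) v (N j s) *\<^sub>R N j s)
           in N i s = (1 / sqrt (g (\<gamma> s) w w)) *\<^sub>R w))"

text \<open>
  The condition \<open>2 \<le> m\<close> expresses that the principal normal \<open>N 2\<close> exists.
\<close>

definition slant_helix ::
  "nat \<Rightarrow> ('a \<Rightarrow> ('a, 'e) tvec \<Rightarrow> ('a, 'e) tvec \<Rightarrow> real) \<Rightarrow>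
     real set \<Rightarrow> (real \<Rightarrow> 'a) \<Rightarrow> (nat \<Rightarrow> real \<Rightarrow> ('a, 'e) tvec) \<Rightarrow>
     ('a \<Rightarrow> ('a, 'e) tvec) \<Rightarrow> real \<Rightarrow> bool" where
  "slant_helix m g I \<gamma> N V \<theta> \<longleftrightarrow>
     2 \<le> m \<and> (\<forall>s\<in>I. g (\<gamma> s) (V (\<gamma> s)) (N 2 s) = cos \<theta>)"

definition concircular_along ::
  "('a, 'e::euclidean_space) chart set \<Rightarrow>
     (('a \<Rightarrow> ('a, 'e) tvec) \<Rightarrow> ('a \<Rightarrow> ('a, 'e) tvec) \<Rightarrow> 'a \<Rightarrow> ('a, 'e) tvec) \<Rightarrow>
     real set \<Rightarrow> (real \<Rightarrow> 'a) \<Rightarrow> ('a \<Rightarrow> ('a, 'e) tvec) \<Rightarrow> ('a \<Rightarrow> real) \<Rightarrow> bool" where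
  "concircular_along A D I \<gamma> V \<rho> \<longleftrightarrow>
     (\<forall>s\<in>I. cov_deriv A D I \<gamma> (\<lambda>t. V (\<gamma> t)) s = \<rho> (\<gamma> s) *\<^sub>R tangent_field A I \<gamma> s)"

end

theory Submission
  imports Defs
begin

text \<open>
  The third alternative always holds.  Put \<open>f\<^sub>i = \<langle>V, N\<^sub>i\<rangle>\<close>.  The frame is orthonormal and has
  as many members as the manifold has dimensions, so \<open>V = \<Sum> f\<^sub>i N\<^sub>i\<close>
  (\<open>orthonormal_expansion\<close>), and \<open>f\<^sub>2 = cos \<theta>\<close> because \<open>\<gamma>\<close> is a slant helix.  Metric
  compatibility along \<open>\<gamma>\<close> (\<open>metric_along_derivative\<close>) and \<open>\<nabla>\<^sub>T V = \<rho> (T - \<langle>T, V\<rangle> V)\<close>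
  (\<open>cov_deriv_anti_torqued\<close>) give

  \<open>f\<^sub>i' = \<rho> (\<delta>\<^sub>1\<^sub>i - f\<^sub>1 f\<^sub>i) + \<langle>V, \<nabla>\<^sub>T N\<^sub>i\<rangle>\<close>

  and substituting the Frenet equations for \<open>\<nabla>\<^sub>T N\<^sub>i\<close> turns this into the equations of the
  system; the second one expresses that the derivative of the constant \<open>f\<^sub>2\<close> vanishes.

  The work lies in the two facts about covariant derivatives along \<open>\<gamma>\<close>, where this derivative
  is a formula in charts, whereas the connection and the anti-torqued condition speak of vector
  fields on open sets.  Expanding fields in coordinate fields leads from one to the other.  The
  anti-torqued condition moreover concerns fields on the whole manifold, and these have to be shown
  to attain every tangent vector: a coordinate field times a bump function supported in the chart
  extends by zero (\<open>cutoff_coord_field\<close>), and tensoriality of \<open>\<nabla>\<^sub>X V\<close> in \<open>X\<close> removes the bump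
  again (\<open>anti_torqued_coord_field\<close>).  The smoothness claims rest on a calculus of
  \<open>smooth_on\<close> that covers open sets and intervals with their endpoints alike.
\<close>

section \<open>Calculus of smooth maps on sets with unique derivatives\<close>

text \<open>
  The points of \<open>S\<close> can be approached within \<open>S\<close> along each coordinate axis; this is what makes
  derivatives within \<open>S\<close> unique.  Open sets and relatively open subsets of nondegenerate
  intervals are both of this kind, so that the two sorts of domain in the definition of
  \<open>smooth_on\<close> are treated at once.
\<close>

definition axis_dense :: "'b::euclidean_space set \<Rightarrow> bool" where
  "axis_dense S \<longleftrightarrow>
     (\<forall>x\<in>S. \<forall>b\<in>Basis. \<forall>e>0. \<exists>d. 0 < \<bar>d\<bar> \<and> \<bar>d\<bar> < e \<and> x + d *\<^sub>R b \<in> S)"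

lemma axis_dense_open:
  assumes "open S"
  shows "axis_dense S"
  unfolding axis_dense_def
proof (intro ballI allI impI)
  fix x b :: 'a and e :: real
  assume x: "x \<in> S" and b: "b \<in> Basis" and e: "e > 0"
  obtain r where r: "r > 0" "ball x r \<subseteq> S"
    using assms x openE by blast
  let ?d = "min r e / 2"
  have "dist x (x + ?d *\<^sub>R b) < r"
    using b e r by (simp add: dist_norm)
  then have "x + ?d *\<^sub>R b \<in> S"
    using r by auto
  then show "\<exists>d. 0 < \<bar>d\<bar> \<and> \<bar>d\<bar> < e \<and> x + d *\<^sub>R b \<in> S"
    using e r by (intro exI[of _ ?d]) auto
qed

lemma axis_dense_relopen:
  assumes "axis_dense S" "openin (top_of_set S) T"
  shows "axis_dense T"
  unfolding axis_dense_def
proof (intro ballI allI impI)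
  fix x b :: 'a and e :: real
  assume x: "x \<in> T" and b: "b \<in> Basis" and e: "e > 0"
  obtain r where r: "r > 0" "ball x r \<inter> S \<subseteq> T"
    using assms(2) x by (meson openin_contains_ball)
  have "x \<in> S"
    using assms(2) x openin_imp_subset by blast
  then obtain d where d: "0 < \<bar>d\<bar>" "\<bar>d\<bar> < min r e" "x + d *\<^sub>R b \<in> S"
    using assms(1) b e r unfolding axis_dense_def by (metis min_less_iff_conj)
  have "x + d *\<^sub>R b \<in> ball x r"
    using b d by (simp add: dist_norm)
  then show "\<exists>d. 0 < \<bar>d\<bar> \<and> \<bar>d\<bar> < e \<and> x + d *\<^sub>R b \<in> T"
    using d r by auto
qed

lemma axis_dense_interval:
  fixes I :: "real set"
  assumes I: "is_interval I" and ne: "interior I \<noteq> {}"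
  shows "axis_dense I"
  unfolding axis_dense_def
proof (intro ballI allI impI)
  fix x b e :: real
  assume x: "x \<in> I" and b: "b \<in> Basis" and e: "e > 0"
  \<comment> \<open>Convexity makes the segment from \<open>x\<close> to any other point \<open>y\<close> of \<open>I\<close> lie in \<open>I\<close>.\<close>
  obtain z r where zr: "r > 0" "ball z r \<subseteq> I"
    using ne by (meson ex_in_conv mem_interior)
  have "z \<in> I" "z + r/2 \<in> I"
    using zr by (auto simp: dist_real_def subset_iff)
  then obtain y where y: "y \<in> I" "y \<noteq> x"
    using zr(1) by (cases "z = x") auto
  let ?t = "min 1 (e / (2 * \<bar>y - x\<bar>))"
  have t: "0 < ?t" "?t \<le> 1" "?t * \<bar>y - x\<bar> < e"
    using e y by (auto simp: min_def field_simps)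
  have "x + ?t * (y - x) \<in> I"
  proof -
    have "convex I"
      using I by (simp add: is_interval_convex)
    then have "(1 - ?t) *\<^sub>R x + ?t *\<^sub>R y \<in> I"
      using t(1,2) x y by (intro convexD_alt) auto
    then show ?thesis
      by (simp add: algebra_simps)
  qed
  moreover have "\<bar>?t * (y - x)\<bar> = ?t * \<bar>y - x\<bar>"
    using t by (simp add: abs_mult)
  ultimately show "\<exists>d. 0 < \<bar>d\<bar> \<and> \<bar>d\<bar> < e \<and> x + d *\<^sub>R b \<in> I"
    using b t y by (intro exI[of _ "?t * (y - x)"]) auto
qed

lemma frechet_derivative_within_eq:
  assumes S: "axis_dense S" and x: "x \<in> S"
    and F: "(f has_derivative F) (at x within S)"
  shows "frechet_derivative f (at x within S) = F"
proof (rule frechet_derivative_unique_within[where x=x and S=S and f=f])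
  show "(f has_derivative frechet_derivative f (at x within S)) (at x within S)"
    using F differentiableI frechet_derivative_works by blast
qed (use S x F in \<open>auto simp: axis_dense_def\<close>)

lemma Ck_on_cong:
  assumes "\<And>x. x \<in> S \<Longrightarrow> f x = g x"
  shows "Ck_on k S f \<longleftrightarrow> Ck_on k S g"
  using assms
proof (induction k arbitrary: f g)
  case 0
  then show ?case
    by (auto intro: continuous_on_eq)
next
  case (Suc k)
  have deriv: "(f has_derivative F) (at x within S) \<longleftrightarrow> (g has_derivative F) (at x within S)"
    if "x \<in> S" for x F
    using has_derivative_transform[OF that] Suc.prems by metis
  have "f differentiable_on S \<longleftrightarrow> g differentiable_on S"
    unfolding differentiable_on_def differentiable_def using deriv by auto
  moreover have "frechet_derivative f (at x within S) = frechet_derivative g (at x within S)"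
    if "x \<in> S" for x
    unfolding frechet_derivative_def using deriv[OF that] by simp
  then have "Ck_on k S (\<lambda>x. frechet_derivative f (at x within S) v) \<longleftrightarrow>
      Ck_on k S (\<lambda>x. frechet_derivative g (at x within S) v)" for v
    by (intro Suc.IH) auto
  ultimately show ?case
    by simp
qed

text \<open>
  Uniqueness of derivatives allows \<open>Ck_on\<close> to be established from any explicit derivative \<open>F\<close>
  instead of the one chosen by \<open>frechet_derivative\<close>.
\<close>

lemma Ck_on_SucI:
  assumes "axis_dense S"
    and F: "\<And>x. x \<in> S \<Longrightarrow> (f has_derivative F x) (at x within S)"
    and "\<And>v. Ck_on k S (\<lambda>x. F x v)"
  shows "Ck_on (Suc k) S f"
proof -
  have "f differentiable_on S"
    unfolding differentiable_on_def differentiable_def using F by blast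
  moreover have "Ck_on k S (\<lambda>x. frechet_derivative f (at x within S) v)" for v
    using assms(3)[of v] Ck_on_cong[of S "\<lambda>x. F x v"] frechet_derivative_within_eq assms(1) F
    by (metis (no_types, lifting))
  ultimately show ?thesis
    by simp
qed

lemma Ck_on_Suc_has_derivative:
  assumes "Ck_on (Suc k) S f" "x \<in> S"
  shows "(f has_derivative frechet_derivative f (at x within S)) (at x within S)"
  using assms by (simp add: differentiable_on_def frechet_derivative_works)

lemma Ck_on_Suc_frechet_derivative:
  assumes "Ck_on (Suc k) S f"
  shows "Ck_on k S (\<lambda>x. frechet_derivative f (at x within S) v)"
  using assms by simp

lemma Ck_on_Suc_imp:
  assumes "Ck_on (Suc k) S f"
  shows "Ck_on k S f"
  using assms
proof (induction k arbitrary: f)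
  case 0
  then show ?case
    by (simp add: differentiable_imp_continuous_on)
next
  case (Suc k)
  then show ?case
    by (metis Ck_on.simps(2))
qed

lemma Ck_on_const:
  assumes "axis_dense S"
  shows "Ck_on k S (\<lambda>_. a)"
proof (induction k arbitrary: a)
  case (Suc k)
  show ?case
    by (rule Ck_on_SucI[OF assms, where F = "\<lambda>_ _. 0"]) (auto intro!: Suc.IH derivative_eq_intros)
qed simp

lemma Ck_on_add:
  assumes "axis_dense S" "Ck_on k S f" "Ck_on k S g"
  shows "Ck_on k S (\<lambda>x. f x + g x)"
  using assms(2,3)
proof (induction k arbitrary: f g)
  case 0
  then show ?case
    by (auto intro: continuous_intros)
next
  case (Suc k)
  show ?case
    by (rule Ck_on_SucI[OF assms(1)], rule has_derivative_add[OF
          Ck_on_Suc_has_derivative[OF Suc.prems(1)] Ck_on_Suc_has_derivative[OF Suc.prems(2)]])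
      (use Suc in \<open>auto simp del: Ck_on.simps intro!: Suc.IH Ck_on_Suc_frechet_derivative\<close>)
qed

lemma (in bounded_linear) Ck_on_image:
  fixes h :: "'c::euclidean_space \<Rightarrow> 'a"
  assumes "axis_dense S" "Ck_on k S h"
  shows "Ck_on k S (\<lambda>x. f (h x))"
  using assms(2)
proof (induction k arbitrary: h)
  case 0
  then show ?case
    by (simp add: continuous_on)
next
  case (Suc k)
  show ?case
    by (rule Ck_on_SucI[OF assms(1)], rule has_derivative[OF
          Ck_on_Suc_has_derivative[OF Suc.prems(1)]])
      (use Suc in \<open>auto simp del: Ck_on.simps intro!: Suc.IH Ck_on_Suc_frechet_derivative\<close>)
qed

lemma (in bounded_bilinear) Ck_on_prod:
  fixes f :: "'d::euclidean_space \<Rightarrow> 'a" and h :: "'d \<Rightarrow> 'b"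
  assumes "axis_dense S" "Ck_on k S f" "Ck_on k S h"
  shows "Ck_on k S (\<lambda>x. prod (f x) (h x))"
  using assms(2,3)
proof (induction k arbitrary: f h)
  case 0
  then show ?case
    by (simp add: continuous_on)
next
  case (Suc k)
  show ?case
    by (rule Ck_on_SucI[OF assms(1)], rule FDERIV[OF
          Ck_on_Suc_has_derivative[OF Suc.prems(1)] Ck_on_Suc_has_derivative[OF Suc.prems(2)]],
        assumption, assumption)
      (use Suc in \<open>auto simp del: Ck_on.simps intro!: Suc.IH Ck_on_add assms(1)
          Ck_on_Suc_frechet_derivative intro: Ck_on_Suc_imp\<close>)
qed

lemma Ck_on_sum:
  assumes "axis_dense S" "\<And>i. i \<in> J \<Longrightarrow> Ck_on k S (f i)"
  shows "Ck_on k S (\<lambda>x. \<Sum>i\<in>J. f i x)"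
  using assms(2)
  by (induction J rule: infinite_finite_induct)
    (auto intro: Ck_on_const Ck_on_add assms(1))

lemma Ck_on_subset:
  assumes "axis_dense S" "axis_dense T" "T \<subseteq> S" "Ck_on k S f"
  shows "Ck_on k T f"
  using assms(4)
proof (induction k arbitrary: f)
  case 0
  then show ?case
    using assms(3) continuous_on_subset by auto
next
  case (Suc k)
  show ?case
  proof (rule Ck_on_SucI[OF assms(2)])
    show "(f has_derivative frechet_derivative f (at x within S)) (at x within T)"
      if "x \<in> T" for x
      using Ck_on_Suc_has_derivative[OF Suc.prems] assms(3) that has_derivative_subset by blast
  qed (use Suc in \<open>auto intro: Suc.IH\<close>)
qed

lemma at_within_relopen:
  fixes S T :: "'b::metric_space set"
  assumes "openin (top_of_set S) T" "x \<in> T"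
  shows "at x within T = at x within S"
proof -
  obtain U where U: "open U" "T = S \<inter> U"
    using assms(1) by (auto simp: openin_open)
  then show ?thesis
    using assms(2) by (intro at_within_nhd[of x U]) auto
qed

text \<open>
  Passing to a relatively open subset changes neither continuity nor derivatives at its points.
\<close>

lemma Ck_on_local:
  assumes S: "axis_dense S"
    and loc: "\<And>x. x \<in> S \<Longrightarrow> \<exists>T. openin (top_of_set S) T \<and> x \<in> T \<and> Ck_on k T f"
  shows "Ck_on k S f"
  using loc
proof (induction k arbitrary: f)
  case 0
  show ?case
    unfolding Ck_on.simps continuous_on_eq_continuous_within
  proof
    fix x assume "x \<in> S"
    then obtain T where T: "openin (top_of_set S) T" "x \<in> T" "continuous_on T f"
      using 0 by auto
    then show "continuous (at x within S) f"
      by (metis at_within_relopen continuous_on_eq_continuous_within)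
  qed
next
  case (Suc k)
  show ?case
  proof (rule Ck_on_SucI[OF S])
    fix x assume "x \<in> S"
    then obtain T where T: "openin (top_of_set S) T" "x \<in> T" "Ck_on (Suc k) T f"
      using Suc.prems by blast
    then show "(f has_derivative frechet_derivative f (at x within S)) (at x within S)"
      using Ck_on_Suc_has_derivative[OF T(3,2)] at_within_relopen[OF T(1,2)] by simp
  next
    fix v
    show "Ck_on k S (\<lambda>x. frechet_derivative f (at x within S) v)"
    proof (rule Suc.IH)
      fix x assume "x \<in> S"
      then obtain T where T: "openin (top_of_set S) T" "x \<in> T" "Ck_on (Suc k) T f"
        using Suc.prems by blast
      have "Ck_on k T (\<lambda>x. frechet_derivative f (at x within S) v)"
        using Ck_on_Suc_frechet_derivative[OF T(3), of v] at_within_relopen[OF T(1)]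
        by (subst Ck_on_cong[where g = "\<lambda>x. frechet_derivative f (at x within T) v"]) auto
      then show "\<exists>T. openin (top_of_set S) T \<and> x \<in> T \<and>
          Ck_on k T (\<lambda>x. frechet_derivative f (at x within S) v)"
        using T by blast
    qed
  qed
qed

text \<open>
  In the chain rule \<open>x \<mapsto> h' (f x) (f' x v)\<close> both the base point and the direction vary with \<open>x\<close>.
  Expanding the direction in the standard basis gives a sum of products of functions to which the
  induction hypothesis applies.
\<close>

lemma Ck_on_compose:
  fixes f :: "'b::euclidean_space \<Rightarrow> 'c::euclidean_space"
    and h :: "'c \<Rightarrow> 'd::real_normed_vector"
  assumes S: "axis_dense S" and f: "Ck_on k S f" and sub: "f ` S \<subseteq> U" and h: "Ck_on k U h"
  shows "Ck_on k S (\<lambda>x. h (f x))"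
  using f h
proof (induction k arbitrary: h)
  case 0
  then show ?case
    using sub continuous_on_compose2 by (metis Ck_on.simps(1))
next
  case (Suc k)
  let ?f' = "\<lambda>x. frechet_derivative f (at x within S)"
  let ?h' = "\<lambda>y. frechet_derivative h (at y within U)"
  show ?case
  proof (rule Ck_on_SucI[OF S])
    fix x assume x: "x \<in> S"
    show "((\<lambda>x. h (f x)) has_derivative (\<lambda>v. \<Sum>b\<in>Basis. (?f' x v \<bullet> b) *\<^sub>R ?h' (f x) b))
        (at x within S)"
    proof -
      have fx: "f x \<in> U"
        using sub x by auto
      have d: "(h has_derivative ?h' (f x)) (at (f x) within U)"
        using Ck_on_Suc_has_derivative[OF Suc.prems(2) fx] .
      interpret bounded_linear "?h' (f x)"
        using d by (rule has_derivative_bounded_linear)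
      have "(\<Sum>b\<in>Basis. (w \<bullet> b) *\<^sub>R ?h' (f x) b) = ?h' (f x) w" for w
        by (subst (2) euclidean_representation[of w, symmetric]) (simp only: sum scaleR)
      then show ?thesis
        using has_derivative_in_compose[OF Ck_on_Suc_has_derivative[OF Suc.prems(1) x]
            has_derivative_subset[OF d sub]] by simp
    qed
  next
    fix v
    show "Ck_on k S (\<lambda>x. \<Sum>b\<in>Basis. (?f' x v \<bullet> b) *\<^sub>R ?h' (f x) b)"
      by (intro Ck_on_sum S bounded_bilinear.Ck_on_prod[OF bounded_bilinear_scaleR]
          bounded_linear.Ck_on_image[OF bounded_linear_inner_left]
          Ck_on_Suc_frechet_derivative Suc.prems Suc.IH Ck_on_Suc_imp[OF Suc.prems(1)])
  qed
qed


lemma smooth_on_cong: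
  assumes "\<And>x. x \<in> S \<Longrightarrow> f x = g x"
  shows "smooth_on S f \<longleftrightarrow> smooth_on S g"
  unfolding smooth_on_def using Ck_on_cong[of S f g] assms by blast

lemma smooth_on_const: "axis_dense S \<Longrightarrow> smooth_on S (\<lambda>_. a)"
  unfolding smooth_on_def by (auto intro: Ck_on_const)

lemma smooth_on_sum:
  assumes "axis_dense S" "\<And>i. i \<in> J \<Longrightarrow> smooth_on S (f i)"
  shows "smooth_on S (\<lambda>x. \<Sum>i\<in>J. f i x)"
  using assms unfolding smooth_on_def by (auto intro: Ck_on_sum)

lemma smooth_on_add:
  "axis_dense S \<Longrightarrow> smooth_on S f \<Longrightarrow> smooth_on S g \<Longrightarrow> smooth_on S (\<lambda>x. f x + g x)"
  unfolding smooth_on_def by (auto intro: Ck_on_add)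

lemma (in bounded_linear) smooth_on_image:
  "axis_dense S \<Longrightarrow> smooth_on S h \<Longrightarrow> smooth_on S (\<lambda>x. f (h x))"
  unfolding smooth_on_def by (auto intro: Ck_on_image)

lemma (in bounded_bilinear) smooth_on_prod:
  "axis_dense S \<Longrightarrow> smooth_on S f \<Longrightarrow> smooth_on S h \<Longrightarrow> smooth_on S (\<lambda>x. prod (f x) (h x))"
  unfolding smooth_on_def by (auto intro: Ck_on_prod)

lemmas smooth_on_scaleR = bounded_bilinear.smooth_on_prod[OF bounded_bilinear_scaleR]
lemmas smooth_on_mult = bounded_bilinear.smooth_on_prod[OF bounded_bilinear_mult]
lemmas smooth_on_inner_left = bounded_linear.smooth_on_image[OF bounded_linear_inner_left]

lemma smooth_on_subset:
  "axis_dense S \<Longrightarrow> axis_dense T \<Longrightarrow> T \<subseteq> S \<Longrightarrow> smooth_on S f \<Longrightarrow> smooth_on T f"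
  unfolding smooth_on_def by (auto intro: Ck_on_subset)

lemma smooth_on_local:
  assumes "axis_dense S"
    and "\<And>x. x \<in> S \<Longrightarrow> \<exists>T. openin (top_of_set S) T \<and> x \<in> T \<and> smooth_on T f"
  shows "smooth_on S f"
  unfolding smooth_on_def
proof
  show "Ck_on k S f" for k
    using assms by (intro Ck_on_local) (auto simp: smooth_on_def)
qed

lemma smooth_on_compose:
  "axis_dense S \<Longrightarrow> smooth_on S f \<Longrightarrow> f ` S \<subseteq> U \<Longrightarrow> smooth_on U h \<Longrightarrow>
     smooth_on S (\<lambda>x. h (f x))"
  unfolding smooth_on_def using Ck_on_compose by blast

lemma smooth_on_has_derivative:
  assumes "smooth_on S f" "x \<in> S"
  shows "(f has_derivative frechet_derivative f (at x within S)) (at x within S)"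
  using assms Ck_on_Suc_has_derivative unfolding smooth_on_def by blast

lemma smooth_on_frechet_derivative:
  assumes "smooth_on S f"
  shows "smooth_on S (\<lambda>x. frechet_derivative f (at x within S) v)"
  using assms Ck_on_Suc_frechet_derivative unfolding smooth_on_def by blast

lemma smooth_on_has_derivative_open:
  assumes "smooth_on S f" "open S" "x \<in> S"
  shows "(f has_derivative frechet_derivative f (at x)) (at x)"
  using smooth_on_has_derivative[OF assms(1,3)] at_within_open[OF assms(3,2)] by simp

lemma smooth_on_frechet_derivative_open:
  assumes "smooth_on S f" "open S"
  shows "smooth_on S (\<lambda>x. frechet_derivative f (at x) v)"
  using smooth_on_frechet_derivative[OF assms(1), of v] at_within_open[OF _ assms(2)]
    smooth_on_cong[of S "\<lambda>x. frechet_derivative f (at x within S) v"] by auto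

lemma smooth_on_ident:
  assumes "axis_dense S"
  shows "smooth_on S (\<lambda>x. x)"
  unfolding smooth_on_def
proof
  fix k
  show "Ck_on k S (\<lambda>x. x)"
  proof (cases k)
    case (Suc j)
    then show ?thesis
      by (auto simp del: Ck_on.simps intro!: Ck_on_SucI[OF assms, where F = "\<lambda>_ v. v"]
          has_derivative_ident Ck_on_const assms)
  qed auto
qed

section \<open>A smooth function with compact support\<close>

text \<open>
  The functions \<open>t\<^sup>-\<^sup>n exp (- 1 / t)\<close>, extended by zero to the left half-line.  Taking all \<open>n\<close> together
  gives a family whose derivatives are again linear combinations of its members, so that smoothness
  follows by induction.
\<close>

definition flat_exp :: "nat \<Rightarrow> real \<Rightarrow> real" where
  "flat_exp n t = (if t > 0 then inverse t ^ n * exp (- inverse t) else 0)"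

lemma flat_exp_derivative:
  "(flat_exp n has_real_derivative flat_exp (n + 2) t - real n * flat_exp (n + 1) t) (at t)"
proof (cases "t = 0")
  case True
  have "((\<lambda>y. inverse y ^ (n + 1) / exp (inverse y)) \<longlongrightarrow> (0::real)) (at_right 0)"
    by (rule filterlim_compose[OF tendsto_power_div_exp_0 filterlim_inverse_at_top_right])
  then have "((\<lambda>y. flat_exp n y / y) \<longlongrightarrow> 0) (at_right 0)"
    by (rule Lim_transform_eventually)
      (auto simp: eventually_at_right_less flat_exp_def exp_minus field_simps
        intro!: eventually_at_rightI[of 0 1])
  moreover have "((\<lambda>y. flat_exp n y / y) \<longlongrightarrow> 0) (at_left 0)"
    by (rule Lim_transform_eventually[OF tendsto_const])
      (auto simp: flat_exp_def intro!: eventually_at_leftI[of "-1"])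
  ultimately have "((\<lambda>y. flat_exp n y / y) \<longlongrightarrow> 0) (at 0)"
    by (simp add: filterlim_split_at)
  then show ?thesis
    using True by (simp add: has_field_derivative_iff flat_exp_def)
next
  case False
  show ?thesis
  proof (cases "t > 0")
    case pos: True
    have "((\<lambda>t. inverse t ^ n * exp (- inverse t)) has_real_derivative
        flat_exp (n + 2) t - real n * flat_exp (n + 1) t) (at t)"
    proof (rule DERIV_cong)
      show "((\<lambda>t. inverse t ^ n * exp (- inverse t)) has_real_derivative
          (real n * inverse t ^ (n - 1) * (- (inverse t * inverse t))) * exp (- inverse t)
          + (inverse t * inverse t) * exp (- inverse t) * inverse t ^ n) (at t)"
        using pos by (auto intro!: derivative_eq_intros)
      have "real n * inverse t ^ (n - 1) * (inverse t * inverse t) = real n * inverse t ^ (n + 1)"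
        by (cases n) auto
      then show "(real n * inverse t ^ (n - 1) * (- (inverse t * inverse t))) * exp (- inverse t)
          + (inverse t * inverse t) * exp (- inverse t) * inverse t ^ n
          = flat_exp (n + 2) t - real n * flat_exp (n + 1) t"
        using pos by (simp add: flat_exp_def)
    qed
    then show ?thesis
      by (rule has_field_derivative_transform_within[where d = t]) (use pos in \<open>auto simp: flat_exp_def dist_real_def\<close>)
  next
    case neg: False
    have "((\<lambda>t. 0) has_real_derivative flat_exp (n + 2) t - real n * flat_exp (n + 1) t) (at t)"
      using neg by (auto simp: flat_exp_def)
    then show ?thesis
      by (rule has_field_derivative_transform_within[where d = "- t"])
        (use False neg in \<open>auto simp: flat_exp_def dist_real_def\<close>)
  qed
qed

lemma smooth_on_flat_exp: "smooth_on UNIV (flat_exp n)"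
  unfolding smooth_on_def
proof
  fix k
  have U: "axis_dense (UNIV :: real set)"
    by (simp add: axis_dense_open)
  show "Ck_on k UNIV (flat_exp n)"
  proof (induction k arbitrary: n)
    case 0
    then show ?case
      using flat_exp_derivative[of n] by (auto intro!: DERIV_continuous_on)
  next
    case (Suc k)
    show ?case
    proof (rule Ck_on_SucI[OF U])
      show "(flat_exp n has_derivative
          (\<lambda>v. (flat_exp (n + 2) x + (- real n) * flat_exp (n + 1) x) * v)) (at x)" for x
        using flat_exp_derivative[of n x] by (simp add: has_field_derivative_def)
      show "Ck_on k UNIV (\<lambda>x. (flat_exp (n + 2) x + (- real n) * flat_exp (n + 1) x) * v)" for v
        by (intro bounded_bilinear.Ck_on_prod[OF bounded_bilinear_mult] Ck_on_add Ck_on_const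
            Suc.IH U)
    qed
  qed
qed

definition bump :: "'e::euclidean_space \<Rightarrow> real \<Rightarrow> 'e \<Rightarrow> real" where
  "bump a r x = flat_exp 0 (r\<^sup>2 - (x - a) \<bullet> (x - a))"

lemma smooth_on_bump:
  fixes a :: "'e::euclidean_space"
  assumes "axis_dense S"
  shows "smooth_on S (bump a r)"
proof -
  have "smooth_on S (\<lambda>x. x + - a)"
    by (intro smooth_on_add smooth_on_ident smooth_on_const assms)
  then have "smooth_on S (\<lambda>x. (x - a) \<bullet> (x - a))"
    using bounded_bilinear.smooth_on_prod[OF bounded_bilinear_inner] assms by auto
  then have "smooth_on S (\<lambda>x. r\<^sup>2 + (-1) * ((x - a) \<bullet> (x - a)))"
    by (intro smooth_on_add smooth_on_mult smooth_on_const assms)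
  from smooth_on_compose[OF assms this subset_UNIV smooth_on_flat_exp[of 0]]
  show ?thesis
    by (simp add: bump_def[abs_def])
qed

lemma bump_center: "r > 0 \<Longrightarrow> bump a r a \<noteq> 0"
  by (simp add: bump_def flat_exp_def)

lemma bump_outside:
  assumes "x \<notin> cball a r" "r > 0"
  shows "bump a r x = 0"
proof -
  have "r < norm (x - a)"
    using assms by (simp add: dist_norm norm_minus_commute)
  then have "r\<^sup>2 < (norm (x - a))\<^sup>2"
    using assms by (simp add: power_strict_mono)
  then show ?thesis
    by (simp add: bump_def flat_exp_def power2_norm_eq_inner)
qed

section \<open>Charts and tangent spaces\<close>

lemma tcoord_simps [simp]:
  "tcoord 0 c = 0"
  "tcoord (v + w) c = tcoord v c + tcoord w c"
  "tcoord (v - w) c = tcoord v c - tcoord w c"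
  "tcoord (- v) c = - tcoord v c"
  "tcoord (a *\<^sub>R v) c = a *\<^sub>R tcoord v c"
  by (simp_all add: zero_tvec_def plus_tvec_def minus_tvec_def uminus_tvec_def scaleR_tvec_def)

lemma tcoord_sum: "tcoord (\<Sum>i\<in>J. v i) c = (\<Sum>i\<in>J. tcoord (v i) c)"
  by (induction J rule: infinite_finite_induct) auto

locale manifold =
  fixes m :: nat and M :: "'a topology" and A :: "('a, 'e::euclidean_space) chart set"
  assumes manifold: "smooth_manifold m M A"
begin

lemma chart_open: "c \<in> A \<Longrightarrow> openin M (cdom c)"
  using manifold unfolding smooth_manifold_def by blast

lemma chart_homeomorphic:
  "c \<in> A \<Longrightarrow>
     homeomorphic_map (subtopology M (cdom c)) (top_of_set (cmap c ` cdom c)) (cmap c)"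
  using manifold unfolding smooth_manifold_def by blast

text \<open>
  The chart is a homeomorphism onto an open image, so relatively open in the image means open.
\<close>

lemma chart_image_open:
  assumes "c \<in> A" "openin M W" "W \<subseteq> cdom c"
  shows "open (cmap c ` W)"
proof -
  have "openin (subtopology M (cdom c)) W"
    using assms chart_open by (simp add: openin_open_subtopology)
  then have "openin (top_of_set (cmap c ` cdom c)) (cmap c ` W)"
    using chart_homeomorphic[OF assms(1)] homeomorphic_imp_open_map open_map_def by blast
  moreover have "open (cmap c ` cdom c)"
    using manifold assms(1) unfolding smooth_manifold_def by blast
  ultimately show ?thesis
    using openin_open_trans by blast
qed

lemma chart_inj: "c \<in> A \<Longrightarrow> inj_on (cmap c) (cdom c)"
  using chart_homeomorphic[of c] chart_open[of c]
  by (auto simp: homeomorphic_map_def dest: openin_subset simp: inf_absorb2)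

lemma cinv_cmap [simp]: "c \<in> A \<Longrightarrow> p \<in> cdom c \<Longrightarrow> cinv c (cmap c p) = p"
  using chart_inj by (simp add: inv_into_f_f)

lemma chart_covers: "p \<in> topspace M \<Longrightarrow> \<exists>c\<in>A. p \<in> cdom c"
  using manifold unfolding smooth_manifold_def by blast

lemma chart_subset: "c \<in> A \<Longrightarrow> cdom c \<subseteq> topspace M"
  using chart_open openin_subset by blast

lemma transition_cmap [simp]: "c \<in> A \<Longrightarrow> p \<in> cdom c \<Longrightarrow> transition c d (cmap c p) = cmap d p"
  by (simp add: transition_def)

lemma chart_topspace: "c \<in> A \<Longrightarrow> p \<in> cdom c \<Longrightarrow> p \<in> topspace M"
  using chart_subset by blast

lemma chart_image_open_Int:
  assumes "c \<in> A" "openin M U"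
  shows "open (cmap c ` (U \<inter> cdom c))"
  using assms by (intro chart_image_open openin_Int chart_open) auto

lemma transition_smooth:
  "c \<in> A \<Longrightarrow> d \<in> A \<Longrightarrow> smooth_on (cmap c ` (cdom c \<inter> cdom d)) (transition c d)"
  using manifold unfolding smooth_manifold_def by blast

text \<open>
  Composition with a transition map; this is why a function on a part of one chart domain needs to be
  tested in that chart only.
\<close>

lemma smooth_change_chart:
  assumes "c \<in> A" "d \<in> A" "openin M U" "U \<subseteq> cdom c" "U \<subseteq> cdom d"
    and F: "smooth_on (cmap c ` U) F"
  shows "smooth_on (cmap d ` U) (\<lambda>x. F (cmap c (cinv d x)))"
proof -
  have o: "open (cmap d ` U)" "open (cmap d ` (cdom d \<inter> cdom c))"
    by (intro chart_image_open openin_Int chart_open; use assms in auto)+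
  have "smooth_on (cmap d ` U) (transition d c)"
    using smooth_on_subset[OF axis_dense_open[OF o(2)] axis_dense_open[OF o(1)] _
        transition_smooth[of d c]] assms by blast
  then have "smooth_on (cmap d ` U) (\<lambda>x. F (transition d c x))"
    by (rule smooth_on_compose[OF axis_dense_open[OF o(1)] _ _ F])
      (use assms in \<open>force simp: subset_iff\<close>)
  then show ?thesis
    by (simp add: transition_def)
qed

lemma smooth_fun_chartI:
  assumes "c \<in> A" "openin M U" "U \<subseteq> cdom c" "smooth_on (cmap c ` U) (\<lambda>x. f (cinv c x))"
  shows "smooth_fun A U f"
  unfolding smooth_fun_def
proof
  fix d assume d: "d \<in> A"
  have o: "openin M (U \<inter> cdom d)"
    using assms d chart_open by blast
  have "smooth_on (cmap c ` (U \<inter> cdom d)) (\<lambda>x. f (cinv c x))"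
    by (rule smooth_on_subset[OF _ _ _ assms(4)])
      (use o assms in \<open>auto intro!: axis_dense_open chart_image_open\<close>)
  from smooth_change_chart[OF assms(1) d o _ _ this]
  have "smooth_on (cmap d ` (U \<inter> cdom d)) (\<lambda>x. f (cinv c (cmap c (cinv d x))))"
    using assms by auto
  then show "smooth_on (cmap d ` (U \<inter> cdom d)) (\<lambda>x. f (cinv d x))"
    by (rule smooth_on_cong[THEN iffD1, rotated]) (use assms d in auto)
qed

lemma vector_field_on_subset:
  assumes "vector_field_on A U Y" "openin M U" "openin M W" "W \<subseteq> U"
  shows "vector_field_on A W Y"
  unfolding vector_field_on_def
proof (intro conjI ballI)
  show "Y p \<in> tangent_space A p" if "p \<in> W" for p
    using assms that unfolding vector_field_on_def by blast
next
  fix c assume c: "c \<in> A"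
  have "open (cmap c ` (U \<inter> cdom c))" "open (cmap c ` (W \<inter> cdom c))"
    using chart_image_open_Int[OF c] assms(2,3) by blast+
  moreover have "smooth_on (cmap c ` (U \<inter> cdom c)) (\<lambda>x. tcoord (Y (cinv c x)) c)"
    using assms(1) c unfolding vector_field_on_def by blast
  ultimately show "smooth_on (cmap c ` (W \<inter> cdom c)) (\<lambda>x. tcoord (Y (cinv c x)) c)"
    using assms(4) by (elim smooth_on_subset[OF axis_dense_open axis_dense_open, rotated 3]) blast+
qed

lemma transition_has_derivative:
  assumes "c \<in> A" "d \<in> A" "p \<in> cdom c" "p \<in> cdom d"
  shows "(transition c d has_derivative frechet_derivative (transition c d) (at (cmap c p)))
           (at (cmap c p))"
proof (rule smooth_on_has_derivative_open[OF transition_smooth])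
  show "open (cmap c ` (cdom c \<inter> cdom d))"
    by (intro chart_image_open openin_Int chart_open) (use assms in auto)
qed (use assms in auto)

lemma transition_linear:
  assumes "c \<in> A" "d \<in> A" "p \<in> cdom c" "p \<in> cdom d"
  shows "linear (frechet_derivative (transition c d) (at (cmap c p)))"
  using transition_has_derivative[OF assms] has_derivative_linear by blast

text \<open>
  The chain rule for \<open>transition d k \<circ> transition c d\<close>, which agrees with \<open>transition c k\<close> near the
  image of \<open>p\<close>.
\<close>

lemma transition_derivative_cocycle:
  assumes "c \<in> A" "d \<in> A" "k \<in> A" "p \<in> cdom c" "p \<in> cdom d" "p \<in> cdom k"
  shows "frechet_derivative (transition d k) (at (cmap d p))
           (frechet_derivative (transition c d) (at (cmap c p)) u)
         = frechet_derivative (transition c k) (at (cmap c p)) u"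
proof -
  let ?O = "cmap c ` (cdom c \<inter> cdom d \<inter> cdom k)"
  have O: "open ?O" "cmap c p \<in> ?O"
    by (intro chart_image_open openin_Int chart_open imageI; use assms in auto)+
  have "((\<lambda>x. transition d k (transition c d x)) has_derivative
      (\<lambda>u. frechet_derivative (transition d k) (at (cmap d p))
             (frechet_derivative (transition c d) (at (cmap c p)) u))) (at (cmap c p))"
    using has_derivative_compose[OF transition_has_derivative[of c d p]]
      transition_has_derivative[of d k p] assms by simp
  then have "(transition c k has_derivative
      (\<lambda>u. frechet_derivative (transition d k) (at (cmap d p))
             (frechet_derivative (transition c d) (at (cmap c p)) u))) (at (cmap c p))"
    by (rule has_derivative_transform_within_open[OF _ O]) (use assms in auto)
  from has_derivative_unique[OF this transition_has_derivative[of c k p]] assms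
  show ?thesis
    by metis
qed

lemma transition_derivative_self:
  assumes "c \<in> A" "p \<in> cdom c"
  shows "frechet_derivative (transition c c) (at (cmap c p)) u = u"
proof -
  have "((\<lambda>x. x) has_derivative (\<lambda>u. u)) (at (cmap c p))"
    by simp
  then have "(transition c c has_derivative (\<lambda>u. u)) (at (cmap c p))"
    by (rule has_derivative_transform_within_open[of _ _ _ _ "cmap c ` cdom c"])
      (use assms chart_image_open[OF _ chart_open] in auto)
  then show ?thesis
    using frechet_derivative_at by metis
qed

subsection \<open>Tangent vectors and their components\<close>

lemma tangent_transform:
  "v \<in> tangent_space A p \<Longrightarrow> c \<in> A \<Longrightarrow> d \<in> A \<Longrightarrow> p \<in> cdom c \<Longrightarrow> p \<in> cdom d \<Longrightarrow>
     tcoord v d = frechet_derivative (transition c d) (at (cmap c p)) (tcoord v c)"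
  unfolding tangent_space_def by blast

lemma tangent_default:
  "v \<in> tangent_space A p \<Longrightarrow> \<not> (c \<in> A \<and> p \<in> cdom c) \<Longrightarrow> tcoord v c = 0"
  unfolding tangent_space_def by blast

lemma tangentI:
  assumes "\<And>c d. c \<in> A \<Longrightarrow> d \<in> A \<Longrightarrow> p \<in> cdom c \<Longrightarrow> p \<in> cdom d \<Longrightarrow>
      tcoord v d = frechet_derivative (transition c d) (at (cmap c p)) (tcoord v c)"
    and "\<And>c. \<not> (c \<in> A \<and> p \<in> cdom c) \<Longrightarrow> tcoord v c = 0"
  shows "v \<in> tangent_space A p"
  using assms unfolding tangent_space_def by blast

lemma tangent_zero: "0 \<in> tangent_space A p"
  by (rule tangentI) (simp_all add: linear_0 transition_linear)

lemma tangent_add: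
  assumes "v \<in> tangent_space A p" "w \<in> tangent_space A p"
  shows "v + w \<in> tangent_space A p"
proof (rule tangentI)
  fix c d assume "c \<in> A" "d \<in> A" "p \<in> cdom c" "p \<in> cdom d"
  note * = this
  show "tcoord (v + w) d = frechet_derivative (transition c d) (at (cmap c p)) (tcoord (v + w) c)"
    using tangent_transform[OF assms(1) *] tangent_transform[OF assms(2) *]
    by (simp add: linear_add[OF transition_linear[OF *]])
qed (use assms tangent_default in simp)

lemma tangent_scaleR:
  assumes "v \<in> tangent_space A p"
  shows "a *\<^sub>R v \<in> tangent_space A p"
proof (rule tangentI)
  fix c d assume "c \<in> A" "d \<in> A" "p \<in> cdom c" "p \<in> cdom d"
  note * = this
  show "tcoord (a *\<^sub>R v) d = frechet_derivative (transition c d) (at (cmap c p)) (tcoord (a *\<^sub>R v) c)"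
    using tangent_transform[OF assms *]
    by (simp add: linear_cmul[OF transition_linear[OF *]])
qed (use assms tangent_default in simp)

lemma tangent_sum:
  "(\<And>i. i \<in> J \<Longrightarrow> v i \<in> tangent_space A p) \<Longrightarrow> (\<Sum>i\<in>J. v i) \<in> tangent_space A p"
  by (induction J rule: infinite_finite_induct) (auto intro: tangent_zero tangent_add)

lemma tangent_diff: "v \<in> tangent_space A p \<Longrightarrow> w \<in> tangent_space A p \<Longrightarrow> v - w \<in> tangent_space A p"
  using tangent_add[of v p "(-1) *\<^sub>R w"] tangent_scaleR[of w p "-1"] by simp

text \<open>
  The transformation law determines all components from those in a single chart.
\<close>

lemma tangent_eqI:
  assumes "v \<in> tangent_space A p" "w \<in> tangent_space A p" "c \<in> A" "p \<in> cdom c"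
    and "tcoord v c = tcoord w c"
  shows "v = w"
proof (rule tvec.expand, rule ext)
  fix d
  show "tcoord v d = tcoord w d"
    using assms tangent_transform[of _ p c d] tangent_default[of _ p d]
    by (cases "d \<in> A \<and> p \<in> cdom d") simp_all
qed

lemma coord_field_tangent:
  assumes "c \<in> A"
  shows "coord_field A c u p \<in> tangent_space A p"
proof (cases "p \<in> cdom c")
  case True
  show ?thesis
    by (rule tangentI; unfold coord_field_def tvec.sel)
      (simp_all only: True assms transition_derivative_cocycle simp_thms if_True if_False split: if_split)
next
  case False
  then have "coord_field A c u p = 0"
    by (simp add: coord_field_def zero_tvec_def)
  then show ?thesis
    using tangent_zero by simp
qed

lemma coord_field_outside: "p \<notin> cdom c \<Longrightarrow> coord_field A c u p = 0"
  by (simp add: coord_field_def zero_tvec_def)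

lemma tcoord_coord_field:
  assumes "c \<in> A" "p \<in> cdom c"
  shows "tcoord (coord_field A c u p) c = u"
  using assms transition_derivative_self by (simp add: coord_field_def)

lemma tangent_eq_coord_field:
  assumes "c \<in> A" "p \<in> cdom c" "v \<in> tangent_space A p"
  shows "coord_field A c (tcoord v c) p = v"
  using assms tangent_eqI coord_field_tangent tcoord_coord_field by blast

lemma coord_field_smooth:
  assumes "c \<in> A" "d \<in> A"
  shows "smooth_on (cmap d ` (cdom c \<inter> cdom d)) (\<lambda>x. tcoord (coord_field A c u (cinv d x)) d)"
proof -
  let ?U = "cdom c \<inter> cdom d"
  have U: "openin M ?U"
    using assms chart_open by blast
  have "smooth_on (cmap c ` ?U) (\<lambda>y. frechet_derivative (transition c d) (at y) u)"
    using assms U by (intro smooth_on_frechet_derivative_open transition_smooth chart_image_open) auto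
  from smooth_change_chart[OF assms U _ _ this]
  have "smooth_on (cmap d ` ?U)
      (\<lambda>x. frechet_derivative (transition c d) (at (cmap c (cinv d x))) u)"
    by auto
  then show ?thesis
    by (rule smooth_on_cong[THEN iffD1, rotated]) (use assms in \<open>auto simp: coord_field_def\<close>)
qed

lemma coord_field_vector_field:
  assumes "c \<in> A"
  shows "vector_field_on A (cdom c) (coord_field A c u)"
  unfolding vector_field_on_def using assms coord_field_tangent coord_field_smooth by blast

text \<open>
  Cutting a coordinate field off with a bump function produces a field on the whole manifold that
  spans any prescribed tangent direction.  The support of the bump is compact in the chart, hence
  closed in the manifold because the manifold is Hausdorff, so the extension by zero is smooth.
\<close>

lemma cutoff_coord_field:
  assumes c: "c \<in> A" and p: "p \<in> cdom c"
  obtains b where "smooth_fun A (cdom c) b" "b p \<noteq> 0"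
    "vector_field_on A (topspace M) (\<lambda>q. b q *\<^sub>R coord_field A c u q)"
proof -
  let ?E = "cmap c ` cdom c"
  have oE: "open ?E"
    using chart_image_open[OF c chart_open] c by simp
  then obtain r where r: "r > 0" "cball (cmap c p) r \<subseteq> ?E"
    using p open_contains_cball by blast
  define b where "b q = bump (cmap c p) r (cmap c q)" for q
  define X where "X q = b q *\<^sub>R coord_field A c u q" for q
  define K where "K = {q \<in> cdom c. cmap c q \<in> cball (cmap c p) r}"
  have bsm: "smooth_fun A (cdom c) b"
  proof (rule smooth_fun_chartI[OF c chart_open[OF c] subset_refl])
    have "smooth_on ?E (bump (cmap c p) r)"
      using smooth_on_bump axis_dense_open oE by blast
    then show "smooth_on ?E (\<lambda>x. b (cinv c x))"
      by (rule smooth_on_cong[THEN iffD1, rotated]) (use c in \<open>auto simp: b_def\<close>)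
  qed
  have "compactin M K"
  proof -
    obtain h where h: "homeomorphic_maps (subtopology M (cdom c)) (top_of_set ?E) (cmap c) h"
      using chart_homeomorphic[OF c] homeomorphic_map_maps by blast
    have "compactin (top_of_set ?E) (cball (cmap c p) r)"
      using r by (simp add: compactin_subtopology)
    then have "compactin (subtopology M (cdom c)) (h ` cball (cmap c p) r)"
      using h image_compactin homeomorphic_maps_def by blast
    moreover have "h ` cball (cmap c p) r = K"
    proof -
      have top: "topspace (subtopology M (cdom c)) = cdom c"
        using chart_subset[OF c] by auto
      have hc: "h (cmap c q) = q" if "q \<in> cdom c" for q
        using h that top unfolding homeomorphic_maps_def by auto
      have "h y \<in> K" if y: "y \<in> cball (cmap c p) r" for y
      proof -
        obtain q where "q \<in> cdom c" "y = cmap c q"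
          using r y by blast
        then show ?thesis
          using hc y unfolding K_def by simp
      qed
      moreover have "q \<in> h ` cball (cmap c p) r" if "q \<in> K" for q
        using that hc unfolding K_def by force
      ultimately show ?thesis
        by blast
    qed
    ultimately show ?thesis
      by (simp add: compactin_subtopology)
  qed
  moreover have "Hausdorff_space M"
    using manifold unfolding smooth_manifold_def by blast
  ultimately have K: "closedin M K"
    by (simp add: compactin_imp_closedin)
  have "vector_field_on A (topspace M) X"
    unfolding vector_field_on_def
  proof (intro conjI ballI)
    show "X q \<in> tangent_space A q" for q
      unfolding X_def by (intro tangent_scaleR coord_field_tangent c)
  next
    fix d assume d: "d \<in> A"
    have dd: "topspace M \<inter> cdom d = cdom d"
      using chart_subset[OF d] by blast
    have od: "open (cmap d ` cdom d)"
      using chart_image_open chart_open d by blast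
    show "smooth_on (cmap d ` (topspace M \<inter> cdom d)) (\<lambda>x. tcoord (X (cinv d x)) d)"
      unfolding dd
    proof (rule smooth_on_local[OF axis_dense_open[OF od]])
      fix x assume "x \<in> cmap d ` cdom d"
      then obtain q where q: "q \<in> cdom d" "x = cmap d q"
        by blast
      show "\<exists>T. openin (top_of_set (cmap d ` cdom d)) T \<and> x \<in> T \<and>
          smooth_on T (\<lambda>x. tcoord (X (cinv d x)) d)"
      proof (cases "q \<in> cdom c")
        case True
        let ?T = "cmap d ` (cdom c \<inter> cdom d)"
        have oT: "open ?T"
          by (intro chart_image_open openin_Int chart_open) (use c d in auto)
        have "smooth_on ?T (\<lambda>x. b (cinv d x))"
          using bsm d unfolding smooth_fun_def by blast
        then have "smooth_on ?T (\<lambda>x. b (cinv d x) *\<^sub>R tcoord (coord_field A c u (cinv d x)) d)"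
          using smooth_on_scaleR axis_dense_open[OF oT] coord_field_smooth[OF c d] by blast
        then have "smooth_on ?T (\<lambda>x. tcoord (X (cinv d x)) d)"
          by (simp add: X_def)
        moreover have "openin (top_of_set (cmap d ` cdom d)) ?T"
          using oT od by (auto simp: openin_open_eq)
        ultimately show ?thesis
          using True q by blast
      next
        case False
        let ?T = "cmap d ` (cdom d - K)"
        have "openin M (cdom d - K)"
          using K d chart_open by blast
        then have oT: "open ?T"
          using d chart_image_open by blast
        have "tcoord (X (cinv d x)) d = 0" if x: "x \<in> ?T" for x
        proof -
          obtain q' where q': "x = cmap d q'" "q' \<in> cdom d" "q' \<notin> K"
            using x by blast
          then have "X q' = 0"
            using bump_outside[of "cmap c q'" "cmap c p" r] r(1) coord_field_outside
            by (cases "q' \<in> cdom c") (auto simp: X_def b_def K_def)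
          then show ?thesis
            using q' d by simp
        qed
        then have "smooth_on ?T (\<lambda>x. tcoord (X (cinv d x)) d)"
          using smooth_on_cong[of ?T "\<lambda>x. tcoord (X (cinv d x)) d" "\<lambda>_. 0"]
            smooth_on_const[OF axis_dense_open[OF oT]] by blast
        moreover have "openin (top_of_set (cmap d ` cdom d)) ?T"
          using oT od by (auto simp: openin_open_eq)
        moreover have "x \<in> ?T"
          using q False by (auto simp: K_def)
        ultimately show ?thesis
          by blast
      qed
    qed
  qed
  moreover have "b p \<noteq> 0"
    using bump_center[OF r(1)] by (simp add: b_def)
  ultimately show ?thesis
    using that bsm unfolding X_def[abs_def] by blast
qed

end

section \<open>The Levi-Civita connection in a chart\<close>

lemma (in manifold) vector_field_on_zero: "openin M U \<Longrightarrow> vector_field_on A U (\<lambda>_. 0)"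
  unfolding vector_field_on_def
  by (auto simp only: tcoord_simps intro!: smooth_on_const axis_dense_open chart_image_open_Int tangent_zero)

lemma (in manifold) vector_field_on_add:
  assumes "openin M U" "vector_field_on A U X" "vector_field_on A U Y"
  shows "vector_field_on A U (\<lambda>q. X q + Y q)"
  using assms unfolding vector_field_on_def
  by (simp add: smooth_on_add tangent_add axis_dense_open chart_image_open_Int)

lemma (in manifold) vector_field_on_scaleR:
  assumes "openin M U" "smooth_fun A U f" "vector_field_on A U Y"
  shows "vector_field_on A U (\<lambda>q. f q *\<^sub>R Y q)"
  using assms unfolding vector_field_on_def smooth_fun_def
  by (simp add: smooth_on_scaleR tangent_scaleR axis_dense_open chart_image_open_Int)

lemma (in manifold) component_smooth:
  assumes "c \<in> A" "vector_field_on A (cdom c) Y"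
  shows "smooth_on (cmap c ` cdom c) (\<lambda>x. tcoord (Y (cinv c x)) c)"
  using assms unfolding vector_field_on_def by (metis Int_absorb)

lemma (in manifold) component_smooth_fun:
  assumes "c \<in> A" "vector_field_on A (cdom c) Y"
  shows "smooth_fun A (cdom c) (\<lambda>q. tcoord (Y q) c \<bullet> i)"
  using assms
  by (intro smooth_fun_chartI[OF assms(1) chart_open[OF assms(1)]] smooth_on_inner_left
      component_smooth axis_dense_open chart_image_open[OF assms(1) chart_open[OF assms(1)]]) auto

lemma (in manifold) vector_field_expansion:
  assumes "c \<in> A" "q \<in> cdom c" "v \<in> tangent_space A q"
  shows "v = (\<Sum>i\<in>Basis. (tcoord v c \<bullet> i) *\<^sub>R coord_field A c i q)"
  using assms
  by (intro tangent_eqI[OF _ _ assms(1,2)] tangent_sum tangent_scaleR coord_field_tangent)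
    (simp_all add: tcoord_sum tcoord_coord_field euclidean_representation)

locale riemannian_manifold = manifold m M A
  for m and M :: "'a topology" and A :: "('a, 'e::euclidean_space) chart set" +
  fixes g D
  assumes metric: "riemannian_metric M A g" and levi_civita: "levi_civita M A g D"
begin

lemma metric_sym:
  "p \<in> topspace M \<Longrightarrow> u \<in> tangent_space A p \<Longrightarrow> v \<in> tangent_space A p \<Longrightarrow> g p u v = g p v u"
  using metric unfolding riemannian_metric_def by blast

lemma metric_add:
  "p \<in> topspace M \<Longrightarrow> u \<in> tangent_space A p \<Longrightarrow> v \<in> tangent_space A p \<Longrightarrow>
     w \<in> tangent_space A p \<Longrightarrow> g p (u + v) w = g p u w + g p v w"
  using metric unfolding riemannian_metric_def by blast

lemma metric_scaleR:
  "p \<in> topspace M \<Longrightarrow> u \<in> tangent_space A p \<Longrightarrow> w \<in> tangent_space A p \<Longrightarrow>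
     g p (a *\<^sub>R u) w = a * g p u w"
  using metric unfolding riemannian_metric_def by blast

lemma metric_zero: "p \<in> topspace M \<Longrightarrow> w \<in> tangent_space A p \<Longrightarrow> g p 0 w = 0"
  using metric_scaleR[of p 0 w 0] tangent_zero by simp

lemma metric_sum_left:
  assumes "p \<in> topspace M" "w \<in> tangent_space A p" "\<And>i. i \<in> J \<Longrightarrow> v i \<in> tangent_space A p"
  shows "g p (\<Sum>i\<in>J. a i *\<^sub>R v i) w = (\<Sum>i\<in>J. a i * g p (v i) w)"
  using assms(3)
  by (induction J rule: infinite_finite_induct)
    (auto simp: metric_zero metric_add metric_scaleR tangent_sum tangent_scaleR assms(1,2))

lemma metric_sum_right:
  assumes "p \<in> topspace M" "w \<in> tangent_space A p" "\<And>i. i \<in> J \<Longrightarrow> v i \<in> tangent_space A p"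
  shows "g p w (\<Sum>i\<in>J. a i *\<^sub>R v i) = (\<Sum>i\<in>J. a i * g p w (v i))"
proof -
  have "g p w (\<Sum>i\<in>J. a i *\<^sub>R v i) = g p (\<Sum>i\<in>J. a i *\<^sub>R v i) w"
    using assms by (intro metric_sym tangent_sum tangent_scaleR) auto
  also have "\<dots> = (\<Sum>i\<in>J. a i * g p (v i) w)"
    using assms by (rule metric_sum_left)
  also have "\<dots> = (\<Sum>i\<in>J. a i * g p w (v i))"
    using assms metric_sym by (intro sum.cong) auto
  finally show ?thesis .
qed

lemma metric_sum_sum:
  assumes "p \<in> topspace M" "\<And>i. i \<in> J \<Longrightarrow> v i \<in> tangent_space A p"
    "\<And>j. j \<in> K \<Longrightarrow> w j \<in> tangent_space A p"
  shows "g p (\<Sum>i\<in>J. a i *\<^sub>R v i) (\<Sum>j\<in>K. b j *\<^sub>R w j) = (\<Sum>i\<in>J. \<Sum>j\<in>K. a i * b j * g p (v i) (w j))"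
proof -
  have "g p (\<Sum>i\<in>J. a i *\<^sub>R v i) (\<Sum>j\<in>K. b j *\<^sub>R w j) = (\<Sum>i\<in>J. a i * g p (v i) (\<Sum>j\<in>K. b j *\<^sub>R w j))"
    using assms by (intro metric_sum_left tangent_sum tangent_scaleR) auto
  also have "\<dots> = (\<Sum>i\<in>J. a i * (\<Sum>j\<in>K. b j * g p (v i) (w j)))"
    by (intro sum.cong refl arg_cong[where f = "(*) _"] metric_sum_right) (use assms in auto)
  finally show ?thesis
    by (simp add: sum_distrib_left mult.assoc)
qed

lemma metric_in_chart:
  assumes "c \<in> A" "p \<in> cdom c" "v \<in> tangent_space A p" "w \<in> tangent_space A p"
  shows "g p v w = (\<Sum>i\<in>Basis. \<Sum>j\<in>Basis. (tcoord v c \<bullet> i) * (tcoord w c \<bullet> j) *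
           g p (coord_field A c i p) (coord_field A c j p))"
proof -
  have "g p v w = g p (\<Sum>i\<in>Basis. (tcoord v c \<bullet> i) *\<^sub>R coord_field A c i p)
      (\<Sum>i\<in>Basis. (tcoord w c \<bullet> i) *\<^sub>R coord_field A c i p)"
    by (rule arg_cong2[OF vector_field_expansion[OF assms(1,2,3)] vector_field_expansion[OF assms(1,2,4)]])
  also have "\<dots> = (\<Sum>i\<in>Basis. \<Sum>j\<in>Basis. (tcoord v c \<bullet> i) * (tcoord w c \<bullet> j) *
           g p (coord_field A c i p) (coord_field A c j p))"
    using assms by (intro metric_sum_sum coord_field_tangent chart_topspace)
  finally show ?thesis .
qed

lemma connection: "affine_connection M A D"
  using levi_civita unfolding levi_civita_def by blast

text \<open>
  The clauses of the connection as rules over a fixed open set, so that each can be applied by a single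
  resolution step.
\<close>

context
  fixes U X Y
  assumes U: "openin M U" and X: "vector_field_on A U X" and Y: "vector_field_on A U Y"
begin

lemmas connection_rules =
  connection[unfolded affine_connection_def, THEN spec, THEN spec, THEN spec, THEN mp, OF U,
    THEN mp, OF X, THEN mp, OF Y]

lemma connection_vector_field: "vector_field_on A U (D X Y)"
  by (rule connection_rules[THEN conjunct1])

lemma connection_local:
  assumes "\<And>q. q \<in> U \<Longrightarrow> X' q = X q" "\<And>q. q \<in> U \<Longrightarrow> Y' q = Y q" "p \<in> U"
  shows "D X' Y' p = D X Y p"
  by (rule connection_rules[THEN conjunct2, THEN conjunct1, THEN spec, THEN spec, THEN mp, THEN bspec])
    (simp_all add: assms)

lemma connection_add:
  assumes "vector_field_on A U Y'" "p \<in> U"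
  shows "D X (\<lambda>q. Y q + Y' q) p = D X Y p + D X Y' p"
  by (rule connection_rules[THEN conjunct2, THEN conjunct2, THEN conjunct2, THEN conjunct1, THEN spec,
        THEN mp, OF assms(1), THEN bspec, OF assms(2)])

lemma connection_scaleR_left:
  assumes "smooth_fun A U f" "p \<in> U"
  shows "D (\<lambda>q. f q *\<^sub>R X q) Y p = f p *\<^sub>R D X Y p"
  by (rule connection_rules[THEN conjunct2, THEN conjunct2, THEN conjunct2, THEN conjunct2, THEN spec,
        THEN mp, OF assms(1), THEN bspec, OF assms(2), THEN conjunct1])

lemma connection_Leibniz:
  assumes "smooth_fun A U f" "p \<in> U" "c \<in> A" "p \<in> cdom c"
  shows "D X (\<lambda>q. f q *\<^sub>R Y q) p = dir_deriv c p (X p) f *\<^sub>R Y p + f p *\<^sub>R D X Y p"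
  by (rule connection_rules[THEN conjunct2, THEN conjunct2, THEN conjunct2, THEN conjunct2, THEN spec,
        THEN mp, OF assms(1), THEN bspec, OF assms(2), THEN conjunct2, THEN bspec, OF assms(3),
        THEN mp, OF assms(4)])

end

lemma connection_zero:
  assumes "openin M U" "vector_field_on A U X" "p \<in> U"
  shows "D X (\<lambda>_. 0) p = 0"
  using connection_add[OF assms(1,2) vector_field_on_zero[OF assms(1)]
      vector_field_on_zero[OF assms(1)] assms(3)]
  by simp

lemma connection_sum:
  assumes c: "c \<in> A" "p \<in> cdom c" and X: "vector_field_on A (cdom c) X"
    and f: "\<And>i. i \<in> J \<Longrightarrow> smooth_fun A (cdom c) (f i)"
    and Y: "\<And>i. i \<in> J \<Longrightarrow> vector_field_on A (cdom c) (Y i)"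
  shows "vector_field_on A (cdom c) (\<lambda>q. \<Sum>i\<in>J. f i q *\<^sub>R Y i q) \<and>
     D X (\<lambda>q. \<Sum>i\<in>J. f i q *\<^sub>R Y i q) p
       = (\<Sum>i\<in>J. dir_deriv c p (X p) (f i) *\<^sub>R Y i p + f i p *\<^sub>R D X (Y i) p)"
  using f Y
proof (induction J rule: infinite_finite_induct)
  case (insert j J)
  note U = chart_open[OF c(1)]
  have IH: "vector_field_on A (cdom c) (\<lambda>q. \<Sum>i\<in>J. f i q *\<^sub>R Y i q)"
    "D X (\<lambda>q. \<Sum>i\<in>J. f i q *\<^sub>R Y i q) p
       = (\<Sum>i\<in>J. dir_deriv c p (X p) (f i) *\<^sub>R Y i p + f i p *\<^sub>R D X (Y i) p)"
    by (rule insert.IH[THEN conjunct1] insert.IH[THEN conjunct2]; simp add: insert.prems)+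
  have j: "vector_field_on A (cdom c) (\<lambda>q. f j q *\<^sub>R Y j q)"
    by (intro vector_field_on_scaleR U insert.prems) simp_all
  moreover have "D X (\<lambda>q. f j q *\<^sub>R Y j q) p
      = dir_deriv c p (X p) (f j) *\<^sub>R Y j p + f j p *\<^sub>R D X (Y j) p"
    by (intro connection_Leibniz[OF U X _ _ c(2) c] insert.prems) simp_all
  ultimately show ?case
    using insert.hyps vector_field_on_add[OF U j IH(1)] connection_add[OF U X j IH(1) c(2)] IH(2)
    by simp
qed (simp_all add: vector_field_on_zero chart_open[OF c(1)]
    connection_zero[OF chart_open[OF c(1)] X c(2)])

text \<open>
  Expanding \<open>Y\<close> in the coordinate fields and using the Leibniz rule.  With \<open>Y\<close> a coordinate field it
  yields linearity of the Christoffel map in its second argument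
  (\<open>connection_coord_fields\<close>), and in general the local formula \<open>tcoord_connection\<close>, which has the
  same shape as the definition of the covariant derivative along a curve.
\<close>

lemma connection_in_chart:
  assumes c: "c \<in> A" "p \<in> cdom c" and Y: "vector_field_on A (cdom c) Y"
  shows "D (coord_field A c u) Y p =
     (\<Sum>i\<in>Basis. frechet_derivative (\<lambda>x. tcoord (Y (cinv c x)) c \<bullet> i) (at (cmap c p)) u
           *\<^sub>R coord_field A c i p
         + (tcoord (Y p) c \<bullet> i) *\<^sub>R D (coord_field A c u) (coord_field A c i) p)"
proof -
  note U = chart_open[OF c(1)]
  note X = coord_field_vector_field[OF c(1)]
  have *: "vector_field_on A (cdom c) (\<lambda>q. \<Sum>i\<in>Basis. (tcoord (Y q) c \<bullet> i) *\<^sub>R coord_field A c i q)"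
    "D (coord_field A c u) (\<lambda>q. \<Sum>i\<in>Basis. (tcoord (Y q) c \<bullet> i) *\<^sub>R coord_field A c i q) p
      = (\<Sum>i\<in>Basis. dir_deriv c p (coord_field A c u p) (\<lambda>q. tcoord (Y q) c \<bullet> i) *\<^sub>R coord_field A c i p
         + (tcoord (Y p) c \<bullet> i) *\<^sub>R D (coord_field A c u) (coord_field A c i) p)"
    by (rule connection_sum[OF c X component_smooth_fun[OF c(1) Y]
          coord_field_vector_field[OF c(1)], THEN conjunct1]
        connection_sum[OF c X component_smooth_fun[OF c(1) Y]
          coord_field_vector_field[OF c(1)], THEN conjunct2])+
  have "Y q = (\<Sum>i\<in>Basis. (tcoord (Y q) c \<bullet> i) *\<^sub>R coord_field A c i q)" if "q \<in> cdom c" for q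
    using Y that c(1) vector_field_expansion unfolding vector_field_on_def by blast
  from connection_local[OF U X *(1) _ this c(2)] *(2) show ?thesis
    by (simp add: dir_deriv_def tcoord_coord_field c)
qed

lemma connection_coord_fields:
  assumes c: "c \<in> A" "p \<in> cdom c"
  shows "D (coord_field A c u) (coord_field A c v) p =
     (\<Sum>i\<in>Basis. (v \<bullet> i) *\<^sub>R D (coord_field A c u) (coord_field A c i) p)"
proof -
  have "frechet_derivative (\<lambda>x. tcoord (coord_field A c v (cinv c x)) c \<bullet> i) (at (cmap c p)) u = 0" for i
  proof -
    have "((\<lambda>x. v \<bullet> i) has_derivative (\<lambda>_. 0)) (at (cmap c p))"
      by simp
    then have "((\<lambda>x. tcoord (coord_field A c v (cinv c x)) c \<bullet> i) has_derivative (\<lambda>_. 0)) (at (cmap c p))"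
      by (rule has_derivative_transform_within_open[of _ _ _ _ "cmap c ` cdom c"])
        (use c chart_image_open[OF _ chart_open] in \<open>auto simp: tcoord_coord_field\<close>)
    then show ?thesis
      using frechet_derivative_at by metis
  qed
  then show ?thesis
    using connection_in_chart[OF c coord_field_vector_field[OF c(1)], of u v]
    by (simp add: tcoord_coord_field c)
qed

lemma connection_coord_fields_tangent:
  assumes "c \<in> A" "p \<in> cdom c"
  shows "D (coord_field A c u) (coord_field A c v) p \<in> tangent_space A p"
  using connection_vector_field[OF chart_open[OF assms(1)] coord_field_vector_field[OF assms(1)]
      coord_field_vector_field[OF assms(1)]] assms
  unfolding vector_field_on_def by blast

lemma tcoord_connection:
  assumes c: "c \<in> A" "p \<in> cdom c" and Y: "vector_field_on A (cdom c) Y"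
  shows "tcoord (D (coord_field A c u) Y p) c =
     frechet_derivative (\<lambda>x. tcoord (Y (cinv c x)) c) (at (cmap c p)) u
     + christoffel A D c p u (tcoord (Y p) c)"
proof -
  let ?Y = "\<lambda>x. tcoord (Y (cinv c x)) c"
  have d: "(?Y has_derivative frechet_derivative ?Y (at (cmap c p))) (at (cmap c p))"
    using smooth_on_has_derivative_open[OF component_smooth[OF c(1) Y]] c
      chart_image_open[OF _ chart_open] by blast
  have "frechet_derivative (\<lambda>x. ?Y x \<bullet> i) (at (cmap c p)) u = frechet_derivative ?Y (at (cmap c p)) u \<bullet> i" for i
    using frechet_derivative_at[OF has_derivative_inner_left[OF d, of i]] by metis
  then have "tcoord (D (coord_field A c u) Y p) c =
     (\<Sum>i\<in>Basis. (frechet_derivative ?Y (at (cmap c p)) u \<bullet> i) *\<^sub>R i)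
     + (\<Sum>i\<in>Basis. (tcoord (Y p) c \<bullet> i) *\<^sub>R tcoord (D (coord_field A c u) (coord_field A c i) p) c)"
    by (simp add: connection_in_chart[OF c Y] tcoord_sum tcoord_coord_field c sum.distrib)
  also have "(\<Sum>i\<in>Basis. (tcoord (Y p) c \<bullet> i) *\<^sub>R tcoord (D (coord_field A c u) (coord_field A c i) p) c)
      = christoffel A D c p u (tcoord (Y p) c)"
    unfolding christoffel_def connection_coord_fields[OF c, of u "tcoord (Y p) c"]
    by (simp add: tcoord_sum)
  finally show ?thesis
    by (simp add: euclidean_representation)
qed

lemma metric_smooth_fun:
  assumes "openin M U" "vector_field_on A U Y" "vector_field_on A U Z"
  shows "smooth_fun A U (\<lambda>q. g q (Y q) (Z q))"
  by (rule metric[unfolded riemannian_metric_def, THEN conjunct2, THEN spec, THEN spec, THEN spec,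
        THEN mp, OF assms(1), THEN mp, OF assms(2), THEN mp, OF assms(3)])

lemma metric_compatible:
  assumes "openin M U" "vector_field_on A U X" "vector_field_on A U Y" "vector_field_on A U Z"
    "p \<in> U" "c \<in> A" "p \<in> cdom c"
  shows "dir_deriv c p (X p) (\<lambda>q. g q (Y q) (Z q)) = g p (D X Y p) (Z p) + g p (Y p) (D X Z p)"
  by (rule levi_civita[unfolded levi_civita_def, THEN conjunct2, THEN conjunct2, THEN spec,
        THEN spec, THEN spec, THEN spec, THEN mp, OF assms(1), THEN mp, OF assms(2), THEN mp,
        OF assms(3), THEN mp, OF assms(4), THEN bspec, OF assms(5), THEN bspec, OF assms(6),
        THEN mp, OF assms(7)])

lemma metric_smooth_in_chart:
  assumes c: "c \<in> A"
  shows "smooth_on (cmap c ` cdom c)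
     (\<lambda>x. g (cinv c x) (coord_field A c i (cinv c x)) (coord_field A c j (cinv c x)))"
proof -
  note V = coord_field_vector_field[OF c]
  have "smooth_fun A (cdom c) (\<lambda>q. g q (coord_field A c i q) (coord_field A c j q))"
    by (rule metric_smooth_fun[OF chart_open[OF c] V V])
  from this[unfolded smooth_fun_def, THEN bspec, OF c] show ?thesis
    by simp
qed

text \<open>
  Metric compatibility for three coordinate fields is the formula for the derivatives of the metric
  coefficients.
\<close>

lemma metric_derivative_in_chart:
  assumes c: "c \<in> A" "p \<in> cdom c"
  shows "((\<lambda>x. g (cinv c x) (coord_field A c i (cinv c x)) (coord_field A c j (cinv c x)))
      has_derivative (\<lambda>u. g p (D (coord_field A c u) (coord_field A c i) p) (coord_field A c j p)
         + g p (coord_field A c i p) (D (coord_field A c u) (coord_field A c j) p))) (at (cmap c p))"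
    (is "(?G has_derivative ?G') _")
proof -
  note V = coord_field_vector_field[OF c(1)]
  have "(?G has_derivative frechet_derivative ?G (at (cmap c p))) (at (cmap c p))"
    by (rule smooth_on_has_derivative_open[OF metric_smooth_in_chart[OF c(1)]
          chart_image_open[OF c(1) chart_open[OF c(1)]]]) (use c in auto)
  moreover have "frechet_derivative ?G (at (cmap c p)) = ?G'"
  proof
    fix u
    show "frechet_derivative ?G (at (cmap c p)) u = ?G' u"
      using metric_compatible[OF chart_open[OF c(1)] V V V c(2) c, of u i j]
      by (simp add: dir_deriv_def tcoord_coord_field c)
  qed
  ultimately show ?thesis
    by simp
qed

text \<open>
  The anti-torqued condition is applied to \<open>b \<partial>\<^sub>u\<close> with a cutoff \<open>b\<close>.  Both sides are homogeneous of
  degree one in \<open>b p \<noteq> 0\<close>, which cancels.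
\<close>

lemma anti_torqued_coord_field:
  assumes AT: "anti_torqued M A g D V \<rho>" and c: "c \<in> A" "p \<in> cdom c"
  shows "D (coord_field A c u) V p
     = \<rho> p *\<^sub>R (coord_field A c u p - g p (coord_field A c u p) (V p) *\<^sub>R V p)"
proof -
  note U = chart_open[OF c(1)] and X = coord_field_vector_field[OF c(1), of u]
  have p: "p \<in> topspace M"
    using c by (rule chart_topspace)
  obtain b where b: "smooth_fun A (cdom c) b" "b p \<noteq> 0"
    "vector_field_on A (topspace M) (\<lambda>q. b q *\<^sub>R coord_field A c u q)"
    using cutoff_coord_field[OF c] by blast
  have V: "vector_field_on A (topspace M) V"
    using AT unfolding anti_torqued_def by blast
  then have Vc: "vector_field_on A (cdom c) V"
    using vector_field_on_subset[OF _ openin_topspace U chart_subset[OF c(1)]] by blast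
  have "b p *\<^sub>R D (coord_field A c u) V p = D (\<lambda>q. b q *\<^sub>R coord_field A c u q) V p"
    using connection_scaleR_left[OF U X Vc b(1) c(2)] by simp
  also have "\<dots> = \<rho> p *\<^sub>R (b p *\<^sub>R coord_field A c u p
      - g p (b p *\<^sub>R coord_field A c u p) (V p) *\<^sub>R V p)"
    using AT b(3) p unfolding anti_torqued_def by blast
  also have "g p (b p *\<^sub>R coord_field A c u p) (V p) = b p * g p (coord_field A c u p) (V p)"
    using V p coord_field_tangent[OF c(1)] unfolding vector_field_on_def by (intro metric_scaleR) auto
  finally have "b p *\<^sub>R D (coord_field A c u) V p
     = b p *\<^sub>R (\<rho> p *\<^sub>R (coord_field A c u p - g p (coord_field A c u p) (V p) *\<^sub>R V p))"
    by (simp add: algebra_simps)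
  then show ?thesis
    unfolding scaleR_cancel_left using b(2) by blast
qed

end

section \<open>Fields along a curve\<close>

lemma at_within_axis_dense_ne_bot:
  fixes I :: "real set"
  assumes "axis_dense I" "s \<in> I"
  shows "at s within I \<noteq> bot"
proof -
  have "s islimpt I"
    unfolding islimpt_approachable
  proof (intro allI impI)
    fix e :: real assume "e > 0"
    then obtain d where "0 < \<bar>d\<bar>" "\<bar>d\<bar> < e" "s + d *\<^sub>R 1 \<in> I"
      using assms unfolding axis_dense_def by (metis Basis_real_def singletonI)
    then show "\<exists>x'\<in>I. x' \<noteq> s \<and> dist x' s < e"
      by (intro bexI[of _ "s + d"]) (auto simp: dist_real_def)
  qed
  then show ?thesis
    by (simp add: trivial_limit_within)
qed

locale curve_in_manifold = riemannian_manifold m M A g D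
  for m and M :: "'a topology" and A :: "('a, 'e::euclidean_space) chart set" and g D +
  fixes I :: "real set" and \<gamma> :: "real \<Rightarrow> 'a"
  assumes curve: "smooth_curve M A I \<gamma>"
begin

abbreviation chart_times :: "('a, 'e) chart \<Rightarrow> real set" where
  "chart_times c \<equiv> {s \<in> I. \<gamma> s \<in> cdom c}"

lemma interval_axis_dense: "axis_dense I"
  using curve axis_dense_interval unfolding smooth_curve_def by blast

lemma curve_in_M: "s \<in> I \<Longrightarrow> \<gamma> s \<in> topspace M"
  using curve unfolding smooth_curve_def continuous_map_def by auto

lemma chart_times_open:
  assumes "c \<in> A"
  shows "openin (top_of_set I) (chart_times c)"
proof -
  have "openin (top_of_set I) {s \<in> topspace (top_of_set I). \<gamma> s \<in> cdom c}"
    using curve chart_open[OF assms] unfolding smooth_curve_def continuous_map_def by blast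
  then show ?thesis
    by simp
qed

lemma chart_times_axis_dense: "c \<in> A \<Longrightarrow> axis_dense (chart_times c)"
  using axis_dense_relopen[OF interval_axis_dense chart_times_open] .

lemma at_within_chart_times:
  "c \<in> A \<Longrightarrow> s \<in> I \<Longrightarrow> \<gamma> s \<in> cdom c \<Longrightarrow> at s within chart_times c = at s within I"
  by (intro at_within_relopen chart_times_open) auto

lemma curve_smooth_in_chart: "c \<in> A \<Longrightarrow> smooth_on (chart_times c) (\<lambda>s. cmap c (\<gamma> s))"
  using curve unfolding smooth_curve_def by blast

lemma smooth_on_has_vector_derivative:
  assumes "c \<in> A" "smooth_on (chart_times c) f" "s \<in> I" "\<gamma> s \<in> cdom c"
  shows "(f has_vector_derivative vector_derivative f (at s within I)) (at s within I)"
proof -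
  have "(f has_derivative frechet_derivative f (at s within chart_times c)) (at s within chart_times c)"
    using assms by (intro smooth_on_has_derivative) auto
  then show ?thesis
    unfolding at_within_chart_times[OF assms(1,3,4)]
    using vector_derivative_works differentiableI by blast
qed

lemma along_chart_smooth:
  assumes "c \<in> A" "smooth_on (cmap c ` cdom c) F"
  shows "smooth_on (chart_times c) (\<lambda>s. F (cmap c (\<gamma> s)))"
  by (rule smooth_on_compose[OF chart_times_axis_dense curve_smooth_in_chart _ assms(2)])
    (use assms in auto)

lemma along_chart_has_vector_derivative:
  assumes c: "c \<in> A" and F: "(F has_derivative F') (at (cmap c (\<gamma> s)))"
    and s: "s \<in> I" "\<gamma> s \<in> cdom c"
  shows "((\<lambda>t. F (cmap c (\<gamma> t))) has_vector_derivative F' (tcoord (tangent_field A I \<gamma> s) c))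
           (at s within I)"
proof -
  have "((\<lambda>t. cmap c (\<gamma> t)) has_vector_derivative tcoord (tangent_field A I \<gamma> s) c) (at s within I)"
    using smooth_on_has_vector_derivative[OF c curve_smooth_in_chart[OF c] s] c s
    by (simp add: tangent_field_def)
  from has_derivative_compose[OF this[unfolded has_vector_derivative_def] F]
  show ?thesis
    using has_derivative_linear[OF F] by (simp add: has_vector_derivative_def linear_cmul)
qed

lemma field_along_smooth:
  "c \<in> A \<Longrightarrow> smooth_field_along A I \<gamma> W \<Longrightarrow> smooth_on (chart_times c) (\<lambda>s. tcoord (W s) c)"
  unfolding smooth_field_along_def by blast

lemma field_along_tangent:
  "smooth_field_along A I \<gamma> W \<Longrightarrow> s \<in> I \<Longrightarrow> W s \<in> tangent_space A (\<gamma> s)"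
  unfolding smooth_field_along_def by blast

lemma metric_along_chart:
  assumes "c \<in> A" "smooth_field_along A I \<gamma> W" "smooth_field_along A I \<gamma> Z" "s \<in> chart_times c"
  shows "g (\<gamma> s) (W s) (Z s) = (\<Sum>i\<in>Basis. \<Sum>j\<in>Basis. (tcoord (W s) c \<bullet> i) * (tcoord (Z s) c \<bullet> j) *
           g (cinv c (cmap c (\<gamma> s))) (coord_field A c i (cinv c (cmap c (\<gamma> s))))
             (coord_field A c j (cinv c (cmap c (\<gamma> s)))))"
  using assms metric_in_chart[OF assms(1), of "\<gamma> s" "W s" "Z s"] field_along_tangent by simp

text \<open>
  In a chart the inner product is a sum of products of components and metric coefficients along the
  curve; smoothness on all of \<open>I\<close> is local.
\<close>

lemma metric_along_smooth:
  assumes W: "smooth_field_along A I \<gamma> W" and Z: "smooth_field_along A I \<gamma> Z"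
  shows "smooth_on I (\<lambda>s. g (\<gamma> s) (W s) (Z s))"
proof (rule smooth_on_local[OF interval_axis_dense])
  fix s assume s: "s \<in> I"
  then obtain c where c: "c \<in> A" "\<gamma> s \<in> cdom c"
    using curve_in_M chart_covers by blast
  note d = chart_times_axis_dense[OF c(1)]
  have "smooth_on (chart_times c) (\<lambda>s. \<Sum>i\<in>Basis. \<Sum>j\<in>Basis. (tcoord (W s) c \<bullet> i) * (tcoord (Z s) c \<bullet> j) *
           g (cinv c (cmap c (\<gamma> s))) (coord_field A c i (cinv c (cmap c (\<gamma> s))))
             (coord_field A c j (cinv c (cmap c (\<gamma> s)))))"
    by (intro smooth_on_sum smooth_on_mult smooth_on_inner_left d field_along_smooth c W Z
        along_chart_smooth[OF c(1) metric_smooth_in_chart[OF c(1)]])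
  then have "smooth_on (chart_times c) (\<lambda>s. g (\<gamma> s) (W s) (Z s))"
    by (rule smooth_on_cong[THEN iffD1, rotated]) (rule metric_along_chart[OF c(1) W Z, symmetric])
  then show "\<exists>T. openin (top_of_set I) T \<and> s \<in> T \<and> smooth_on T (\<lambda>s. g (\<gamma> s) (W s) (Z s))"
    using chart_times_open[OF c(1)] s c(2) by blast
qed

lemma tcoord_cov_deriv:
  "c \<in> A \<Longrightarrow> \<gamma> s \<in> cdom c \<Longrightarrow> tcoord (cov_deriv A D I \<gamma> W s) c =
     vector_derivative (\<lambda>t. tcoord (W t) c) (at s within I)
     + christoffel A D c (\<gamma> s) (tcoord (tangent_field A I \<gamma> s) c) (tcoord (W s) c)"
  by (simp add: cov_deriv_def)

text \<open>
  A covariant derivative that is tangent can be recovered from a single chart, where it splits into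
  the derivative of the components and the Christoffel part.
\<close>

lemma cov_deriv_expansion:
  assumes c: "c \<in> A" "\<gamma> s \<in> cdom c" and t: "cov_deriv A D I \<gamma> W s \<in> tangent_space A (\<gamma> s)"
  defines "\<tau> \<equiv> tcoord (tangent_field A I \<gamma> s) c"
  shows "cov_deriv A D I \<gamma> W s
     = (\<Sum>i\<in>Basis. (vector_derivative (\<lambda>t. tcoord (W t) c) (at s within I) \<bullet> i) *\<^sub>R coord_field A c i (\<gamma> s))
       + (\<Sum>i\<in>Basis. (tcoord (W s) c \<bullet> i) *\<^sub>R D (coord_field A c \<tau>) (coord_field A c i) (\<gamma> s))"
    (is "_ = ?R")
proof (rule tangent_eqI[OF t _ c])
  show "?R \<in> tangent_space A (\<gamma> s)"
    using c by (intro tangent_add tangent_sum tangent_scaleR coord_field_tangent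
        connection_coord_fields_tangent)
  have "christoffel A D c (\<gamma> s) \<tau> (tcoord (W s) c)
     = (\<Sum>i\<in>Basis. (tcoord (W s) c \<bullet> i) *\<^sub>R tcoord (D (coord_field A c \<tau>) (coord_field A c i) (\<gamma> s)) c)"
    unfolding christoffel_def connection_coord_fields[OF c, of \<tau> "tcoord (W s) c"]
    by (simp add: tcoord_sum)
  then show "tcoord (cov_deriv A D I \<gamma> W s) c = tcoord ?R c"
    by (simp add: tcoord_cov_deriv c tcoord_sum tcoord_coord_field euclidean_representation \<tau>_def)
qed

text \<open>
  Differentiating \<open>\<Sum> W\<^sup>i Z\<^sup>j g\<^sub>i\<^sub>j\<close> along the curve, the derivative of \<open>g\<^sub>i\<^sub>j\<close> splits by metric compatibility
  into two terms, which are the Christoffel parts of the covariant derivatives of \<open>W\<close> and \<open>Z\<close>.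
\<close>

lemma metric_along_derivative:
  assumes W: "smooth_field_along A I \<gamma> W" and Z: "smooth_field_along A I \<gamma> Z" and s: "s \<in> I"
    and tW: "cov_deriv A D I \<gamma> W s \<in> tangent_space A (\<gamma> s)"
    and tZ: "cov_deriv A D I \<gamma> Z s \<in> tangent_space A (\<gamma> s)"
  shows "((\<lambda>s. g (\<gamma> s) (W s) (Z s)) has_vector_derivative
      g (\<gamma> s) (cov_deriv A D I \<gamma> W s) (Z s) + g (\<gamma> s) (W s) (cov_deriv A D I \<gamma> Z s)) (at s within I)"
proof -
  obtain c where c: "c \<in> A" "\<gamma> s \<in> cdom c"
    using s curve_in_M chart_covers by blast
  let ?p = "\<gamma> s"
  have p: "?p \<in> topspace M"
    using s by (rule curve_in_M)
  let ?e = "\<lambda>i. coord_field A c i ?p"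
  define \<tau> where "\<tau> = tcoord (tangent_field A I \<gamma> s) c"
  let ?De = "\<lambda>i. D (coord_field A c \<tau>) (coord_field A c i) ?p"
  define w where "w = tcoord (W s) c"
  define z where "z = tcoord (Z s) c"
  define w' where "w' = vector_derivative (\<lambda>t. tcoord (W t) c) (at s within I)"
  define z' where "z' = vector_derivative (\<lambda>t. tcoord (Z t) c) (at s within I)"
  let ?G = "\<lambda>i j x. g (cinv c x) (coord_field A c i (cinv c x)) (coord_field A c j (cinv c x))"
  have dW: "((\<lambda>t. tcoord (W t) c) has_vector_derivative w') (at s within I)"
    and dZ: "((\<lambda>t. tcoord (Z t) c) has_vector_derivative z') (at s within I)"
    unfolding w'_def z'_def
    using smooth_on_has_vector_derivative[OF c(1) field_along_smooth[OF c(1)] s c(2)] W Z by blast+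
  have dG: "((\<lambda>t. ?G i j (cmap c (\<gamma> t))) has_real_derivative
      (g ?p (?De i) (?e j) + g ?p (?e i) (?De j))) (at s within I)" for i j
    unfolding has_real_derivative_iff_has_vector_derivative \<tau>_def
    by (rule along_chart_has_vector_derivative[OF c(1) metric_derivative_in_chart[OF c] s c(2)])
  have dWi: "((\<lambda>t. tcoord (W t) c \<bullet> i) has_real_derivative w' \<bullet> i) (at s within I)" for i
    unfolding has_real_derivative_iff_has_vector_derivative
    using bounded_linear.has_vector_derivative[OF bounded_linear_inner_left dW] .
  have dZi: "((\<lambda>t. tcoord (Z t) c \<bullet> i) has_real_derivative z' \<bullet> i) (at s within I)" for i
    unfolding has_real_derivative_iff_has_vector_derivative
    using bounded_linear.has_vector_derivative[OF bounded_linear_inner_left dZ] .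
  have "((\<lambda>t. \<Sum>i\<in>Basis. \<Sum>j\<in>Basis. (tcoord (W t) c \<bullet> i) * (tcoord (Z t) c \<bullet> j) * ?G i j (cmap c (\<gamma> t)))
     has_real_derivative (\<Sum>i\<in>Basis. \<Sum>j\<in>Basis.
        ((w' \<bullet> i) * (z \<bullet> j) + (w \<bullet> i) * (z' \<bullet> j)) * g ?p (?e i) (?e j)
         + (w \<bullet> i) * (z \<bullet> j) * (g ?p (?De i) (?e j) + g ?p (?e i) (?De j)))) (at s within I)"
    (is "(_ has_real_derivative ?d) _")
    by (intro DERIV_sum DERIV_cong[OF DERIV_mult[OF DERIV_mult[OF dWi dZi] dG]])
      (simp add: w_def z_def c algebra_simps)
  then have "((\<lambda>t. \<Sum>i\<in>Basis. \<Sum>j\<in>Basis. (tcoord (W t) c \<bullet> i) * (tcoord (Z t) c \<bullet> j) * ?G i j (cmap c (\<gamma> t)))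
     has_vector_derivative ?d) (at s within chart_times c)"
    by (simp only: has_real_derivative_iff_has_vector_derivative at_within_chart_times[OF c(1) s c(2)])
  then have "((\<lambda>t. g (\<gamma> t) (W t) (Z t)) has_vector_derivative ?d) (at s within chart_times c)"
    by (rule has_vector_derivative_transform[rotated 2])
      (use s c metric_along_chart[OF c(1) W Z] in blast)+
  then have main: "((\<lambda>t. g (\<gamma> t) (W t) (Z t)) has_vector_derivative ?d) (at s within I)"
    by (simp only: at_within_chart_times[OF c(1) s c(2)])
  have Ws: "W s = (\<Sum>i\<in>Basis. (w \<bullet> i) *\<^sub>R ?e i)" and Zs: "Z s = (\<Sum>i\<in>Basis. (z \<bullet> i) *\<^sub>R ?e i)"
    unfolding w_def z_def
    by (intro vector_field_expansion c field_along_tangent W Z s)+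
  note te = coord_field_tangent[OF c(1)]
  note tD = connection_coord_fields_tangent[OF c]
  have gW: "g ?p (cov_deriv A D I \<gamma> W s) (Z s) =
     (\<Sum>i\<in>Basis. \<Sum>j\<in>Basis. (w' \<bullet> i) * (z \<bullet> j) * g ?p (?e i) (?e j))
     + (\<Sum>i\<in>Basis. \<Sum>j\<in>Basis. (w \<bullet> i) * (z \<bullet> j) * g ?p (?De i) (?e j))"
    unfolding cov_deriv_expansion[OF c tW] Zs w'_def[symmetric] \<tau>_def[symmetric] w_def[symmetric]
    by (subst metric_add) (simp_all add: metric_sum_sum p te tD tangent_sum tangent_scaleR)
  have "g ?p (W s) (cov_deriv A D I \<gamma> Z s) = g ?p (cov_deriv A D I \<gamma> Z s) (W s)"
    using p field_along_tangent[OF W s] tZ by (rule metric_sym)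
  also have "\<dots> = (\<Sum>j\<in>Basis. \<Sum>i\<in>Basis. (z' \<bullet> j) * (w \<bullet> i) * g ?p (?e j) (?e i))
     + (\<Sum>j\<in>Basis. \<Sum>i\<in>Basis. (z \<bullet> j) * (w \<bullet> i) * g ?p (?De j) (?e i))"
    unfolding cov_deriv_expansion[OF c tZ] Ws z'_def[symmetric] \<tau>_def[symmetric] z_def[symmetric]
    by (subst metric_add) (simp_all add: metric_sum_sum p te tD tangent_sum tangent_scaleR)
  also have "\<dots> = (\<Sum>i\<in>Basis. \<Sum>j\<in>Basis. (w \<bullet> i) * (z' \<bullet> j) * g ?p (?e i) (?e j))
     + (\<Sum>i\<in>Basis. \<Sum>j\<in>Basis. (w \<bullet> i) * (z \<bullet> j) * g ?p (?e i) (?De j))"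
    using metric_sym[OF p te te] metric_sym[OF p tD te]
    by (subst (1 3) sum.swap) (simp add: mult.commute mult.left_commute)
  finally have gZ: "g ?p (W s) (cov_deriv A D I \<gamma> Z s) = \<dots>" .
  have "g ?p (cov_deriv A D I \<gamma> W s) (Z s) + g ?p (W s) (cov_deriv A D I \<gamma> Z s) = ?d"
    unfolding gW gZ by (simp add: sum.distrib[symmetric] algebra_simps)
  with main show ?thesis
    by simp
qed

lemma field_along_restrict:
  assumes "vector_field_on A (topspace M) V"
  shows "smooth_field_along A I \<gamma> (\<lambda>t. V (\<gamma> t))"
  unfolding smooth_field_along_def
proof (intro conjI ballI)
  show "V (\<gamma> s) \<in> tangent_space A (\<gamma> s)" if "s \<in> I" for s
    using assms curve_in_M[OF that] unfolding vector_field_on_def by blast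
next
  fix c assume c: "c \<in> A"
  have "vector_field_on A (cdom c) V"
    using vector_field_on_subset[OF assms openin_topspace chart_open[OF c] chart_subset[OF c]] .
  then have "smooth_on (chart_times c) (\<lambda>s. tcoord (V (cinv c (cmap c (\<gamma> s)))) c)"
    by (intro along_chart_smooth c component_smooth)
  then show "smooth_on (chart_times c) (\<lambda>s. tcoord (V (\<gamma> s)) c)"
    by (rule smooth_on_cong[THEN iffD1, rotated]) (use c in auto)
qed

text \<open>
  By the chain rule the covariant derivative along \<open>\<gamma>\<close> of a field that is defined on the whole manifold
  has the local formula of \<open>D\<close> in the direction of the tangent.
\<close>

lemma tcoord_cov_deriv_restrict:
  assumes V: "vector_field_on A (topspace M) V" and c: "c \<in> A" "\<gamma> s \<in> cdom c" and s: "s \<in> I"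
  shows "tcoord (cov_deriv A D I \<gamma> (\<lambda>t. V (\<gamma> t)) s) c
     = tcoord (D (coord_field A c (tcoord (tangent_field A I \<gamma> s) c)) V (\<gamma> s)) c"
proof -
  let ?V = "\<lambda>x. tcoord (V (cinv c x)) c"
  let ?\<tau> = "tcoord (tangent_field A I \<gamma> s) c"
  have Vc: "vector_field_on A (cdom c) V"
    using vector_field_on_subset[OF V openin_topspace chart_open[OF c(1)] chart_subset[OF c(1)]] .
  have "(?V has_derivative frechet_derivative ?V (at (cmap c (\<gamma> s)))) (at (cmap c (\<gamma> s)))"
    by (rule smooth_on_has_derivative_open[OF component_smooth[OF c(1) Vc]
          chart_image_open[OF c(1) chart_open[OF c(1)]]]) (use c in auto)
  then have "((\<lambda>t. ?V (cmap c (\<gamma> t))) has_vector_derivative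
      frechet_derivative ?V (at (cmap c (\<gamma> s))) ?\<tau>) (at s within chart_times c)"
    unfolding at_within_chart_times[OF c(1) s c(2)]
    by (rule along_chart_has_vector_derivative[OF c(1) _ s c(2)])
  then have "((\<lambda>t. tcoord (V (\<gamma> t)) c) has_vector_derivative
      frechet_derivative ?V (at (cmap c (\<gamma> s))) ?\<tau>) (at s within chart_times c)"
    by (rule has_vector_derivative_transform[rotated 2]) (use c s in auto)
  then have "vector_derivative (\<lambda>t. tcoord (V (\<gamma> t)) c) (at s within I)
      = frechet_derivative ?V (at (cmap c (\<gamma> s))) ?\<tau>"
    unfolding at_within_chart_times[OF c(1) s c(2)]
    by (rule vector_derivative_within[OF at_within_axis_dense_ne_bot[OF interval_axis_dense s]])
  then show ?thesis
    by (simp add: tcoord_cov_deriv c tcoord_connection[OF c Vc])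
qed

text \<open>
  Each chart gives the component of \<open>D\<close> taken with a coordinate field of that chart; the anti-torqued
  condition shows that these components all belong to one tangent vector.
\<close>

lemma cov_deriv_anti_torqued:
  assumes AT: "anti_torqued M A g D V \<rho>" and s: "s \<in> I"
    and T: "tangent_field A I \<gamma> s \<in> tangent_space A (\<gamma> s)"
  shows "cov_deriv A D I \<gamma> (\<lambda>t. V (\<gamma> t)) s
     = \<rho> (\<gamma> s) *\<^sub>R (tangent_field A I \<gamma> s - g (\<gamma> s) (tangent_field A I \<gamma> s) (V (\<gamma> s)) *\<^sub>R V (\<gamma> s))"
    (is "?L = ?R")
proof -
  have V: "vector_field_on A (topspace M) V"
    using AT unfolding anti_torqued_def by blast
  have R: "?R \<in> tangent_space A (\<gamma> s)"
    by (intro tangent_scaleR tangent_diff T field_along_tangent[OF field_along_restrict[OF V] s])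
  have "tcoord ?L c = tcoord ?R c" for c
  proof (cases "c \<in> A \<and> \<gamma> s \<in> cdom c")
    case True
    then show ?thesis
      using tcoord_cov_deriv_restrict[OF V _ _ s, of c] anti_torqued_coord_field[OF AT, of c "\<gamma> s"]
        tangent_eq_coord_field[OF _ _ T, of c] by simp
  next
    case False
    moreover have "tcoord ?L c = 0"
      using False by (auto simp only: cov_deriv_def tvec.sel if_False)
    ultimately show ?thesis
      using tangent_default[OF R] by simp
  qed
  then show ?thesis
    by (intro tvec.expand ext)
qed

lemma anti_torqued_component_derivative:
  assumes AT: "anti_torqued M A g D V \<rho>" and s: "s \<in> I"
    and T: "tangent_field A I \<gamma> s \<in> tangent_space A (\<gamma> s)"
    and W: "smooth_field_along A I \<gamma> W"
    and tW: "cov_deriv A D I \<gamma> W s \<in> tangent_space A (\<gamma> s)"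
  shows "((\<lambda>t. g (\<gamma> t) (V (\<gamma> t)) (W t)) has_vector_derivative
      \<rho> (\<gamma> s) * (g (\<gamma> s) (tangent_field A I \<gamma> s) (W s)
        - g (\<gamma> s) (V (\<gamma> s)) (tangent_field A I \<gamma> s) * g (\<gamma> s) (V (\<gamma> s)) (W s))
      + g (\<gamma> s) (V (\<gamma> s)) (cov_deriv A D I \<gamma> W s)) (at s within I)"
proof -
  let ?T = "tangent_field A I \<gamma> s" and ?c = "cov_deriv A D I \<gamma> (\<lambda>t. V (\<gamma> t)) s"
  let ?a = "g (\<gamma> s) (V (\<gamma> s)) ?T"
  note p = curve_in_M[OF s]
  have V: "vector_field_on A (topspace M) V"
    using AT unfolding anti_torqued_def by blast
  note Vs = field_along_restrict[OF V]
  note tV = field_along_tangent[OF Vs s]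
  have c: "?c = \<rho> (\<gamma> s) *\<^sub>R (?T + (- ?a) *\<^sub>R V (\<gamma> s))"
    using cov_deriv_anti_torqued[OF AT s T] metric_sym[OF p tV T] by simp
  have tc: "?c \<in> tangent_space A (\<gamma> s)"
    unfolding c by (intro tangent_add tangent_scaleR T tV)
  have "g (\<gamma> s) ?c (W s) = \<rho> (\<gamma> s) * (g (\<gamma> s) ?T (W s) + (- ?a) * g (\<gamma> s) (V (\<gamma> s)) (W s))"
    unfolding c
    by (simp only: metric_add metric_scaleR p tV T field_along_tangent[OF W s] tangent_scaleR
        tangent_add)
  then show ?thesis
    using metric_along_derivative[OF Vs W s tc tW] by simp
qed

end

text \<open>
  Orthonormality makes the chart components of the frame linearly independent; as there are as many of
  them as the dimension of the model space, they span it.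
\<close>

lemma (in riemannian_manifold) orthonormal_expansion:
  assumes p: "p \<in> topspace M" and N: "\<And>i. i \<in> {1..m} \<Longrightarrow> N i \<in> tangent_space A p"
    and on: "\<And>i j. i \<in> {1..m} \<Longrightarrow> j \<in> {1..m} \<Longrightarrow> g p (N i) (N j) = (if i = j then 1 else 0)"
    and v: "v \<in> tangent_space A p"
  shows "v = (\<Sum>i=1..m. g p v (N i) *\<^sub>R N i)"
proof -
  obtain c where c: "c \<in> A" "p \<in> cdom c"
    using p chart_covers by blast
  define n where "n i = tcoord (N i) c" for i
  have comb: "a j = g p (\<Sum>i=1..m. a i *\<^sub>R N i) (N j)" if "j \<in> {1..m}" for a j
  proof -
    have "g p (\<Sum>i=1..m. a i *\<^sub>R N i) (N j) = (\<Sum>i=1..m. a i * g p (N i) (N j))"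
      using p N that by (intro metric_sum_left) auto
    also have "\<dots> = (\<Sum>i=1..m. if i = j then a i else 0)"
      using on that by (intro sum.cong) auto
    finally show ?thesis
      using that by simp
  qed
  have inj: "inj_on n {1..m}"
  proof (rule inj_onI)
    fix i j assume ij: "i \<in> {1..m}" "j \<in> {1..m}" "n i = n j"
    then have "N i = N j"
      using tangent_eqI[OF N N c] unfolding n_def by blast
    then show "i = j"
      using on[of i j] on[of i i] ij by (auto split: if_splits)
  qed
  have "independent (n ` {1..m})"
  proof (rule independent_if_scalars_zero)
    fix f y assume f: "(\<Sum>x\<in>n ` {1..m}. f x *\<^sub>R x) = 0" and y: "y \<in> n ` {1..m}"
    then obtain j where j: "j \<in> {1..m}" "y = n j"
      by blast
    have "(\<Sum>i=1..m. f (n i) *\<^sub>R N i) = 0"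
    proof (rule tangent_eqI[OF tangent_sum tangent_zero c])
      show "tcoord (\<Sum>i=1..m. f (n i) *\<^sub>R N i) c = tcoord 0 c"
        using f unfolding sum.reindex[OF inj] tcoord_sum by (simp add: n_def)
    qed (use N tangent_scaleR in auto)
    then show "f y = 0"
      using comb[OF j(1), of "\<lambda>i. f (n i)"] metric_zero[OF p N[OF j(1)]] j(2) by simp
  qed simp
  moreover have "card (n ` {1..m}) = DIM('e)"
    using manifold card_image[OF inj] unfolding smooth_manifold_def by simp
  ultimately have "tcoord v c \<in> span (n ` {1..m})"
    using card_ge_dim_independent[of "n ` {1..m}" UNIV] by auto
  then obtain a where "tcoord v c = (\<Sum>x\<in>n ` {1..m}. a x *\<^sub>R x)"
    by (auto simp: span_finite)
  then have "tcoord v c = tcoord (\<Sum>i=1..m. a (n i) *\<^sub>R N i) c"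
    unfolding sum.reindex[OF inj] tcoord_sum by (simp add: n_def)
  then have v_eq: "v = (\<Sum>i=1..m. a (n i) *\<^sub>R N i)"
    by (intro tangent_eqI[OF v _ c] tangent_sum tangent_scaleR N)
  have "g p v (N i) = a (n i)" if "i \<in> {1..m}" for i
    using comb[OF that, of "\<lambda>i. a (n i)"] v_eq by simp
  then have "(\<Sum>i=1..m. g p v (N i) *\<^sub>R N i) = (\<Sum>i=1..m. a (n i) *\<^sub>R N i)"
    by (intro sum.cong) auto
  then show ?thesis
    using v_eq by simp
qed

section \<open>Components of the axis of a slant helix\<close>

theorem theorem4p1:
  fixes m r :: nat
    and M :: "'a topology"
    and A :: "('a, 'e::euclidean_space) chart set"
    and \<omega> :: "'a \<Rightarrow> (nat \<Rightarrow> ('a, 'e) tvec) \<Rightarrow> real"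
    and g :: "'a \<Rightarrow> ('a, 'e) tvec \<Rightarrow> ('a, 'e) tvec \<Rightarrow> real"
    and D :: "('a \<Rightarrow> ('a, 'e) tvec) \<Rightarrow> ('a \<Rightarrow> ('a, 'e) tvec) \<Rightarrow> 'a \<Rightarrow> ('a, 'e) tvec"
    and V :: "'a \<Rightarrow> ('a, 'e) tvec"
    and \<rho> :: "'a \<Rightarrow> real"
    and I :: "real set"
    and \<gamma> :: "real \<Rightarrow> 'a"
    and N :: "nat \<Rightarrow> real \<Rightarrow> ('a, 'e) tvec"
    and \<kappa> :: "nat \<Rightarrow> real \<Rightarrow> real"
    and \<theta> :: real
  assumes "smooth_manifold m M A"
    and "connected_space M"
    and "orientation_form m M A \<omega>"
    and "riemannian_metric M A g"
    and "levi_civita M A g D"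
    and "anti_torqued M A g D V \<rho>"
    and "1 \<le> r" and "r \<le> m"
    and "frenet_curve M A D I \<gamma> r"
    and "arc_length_param A g I \<gamma>"
    and "frenet_frame m M A \<omega> g D I \<gamma> N \<kappa>"
    and "0 \<le> \<theta>" and "\<theta> \<le> 2 * pi"
    and "slant_helix m g I \<gamma> N V \<theta>"
  shows
    "(\<forall>s\<in>I. \<kappa> 1 s = 0)
     \<or> (frenet_curve M A D I \<gamma> 2 \<and> (\<forall>s\<in>I. \<rho> (\<gamma> s) = - \<kappa> 1 s) \<and>
        concircular_along A D I \<gamma> V \<rho>)
     \<or> (\<exists>f :: nat \<Rightarrow> real \<Rightarrow> real.
          (\<forall>i\<in>{1} \<union> {3..m}. smooth_on I (f i)) \<and>
          (\<forall>j>m. \<forall>s. f j s = 0) \<and>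
          (\<forall>s\<in>I. V (\<gamma> s) =
             f 1 s *\<^sub>R N 1 s + cos \<theta> *\<^sub>R N 2 s + (\<Sum>i=3..m. f i s *\<^sub>R N i s)) \<and>
          (\<forall>s\<in>I.
             vector_derivative (f 1) (at s within I) - cos \<theta> * \<kappa> 1 s
               - \<rho> (\<gamma> s) * (1 - (f 1 s)\<^sup>2) = 0 \<and>
             \<kappa> 1 s * f 1 s - \<kappa> 2 s * f 3 s + cos \<theta> * \<rho> (\<gamma> s) * f 1 s = 0 \<and>
             (3 \<le> m \<longrightarrow>
               vector_derivative (f 3) (at s within I) + cos \<theta> * \<kappa> 2 s - \<kappa> 3 s * f 4 s
                 + \<rho> (\<gamma> s) * f 1 s * f 3 s = 0) \<and>
             (\<forall>i. 4 \<le> i \<and> i \<le> m - 1 \<longrightarrow>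
               vector_derivative (f i) (at s within I) + \<kappa> (i - 1) s * f (i - 1) s
                 - \<kappa> i s * f (i + 1) s + \<rho> (\<gamma> s) * f 1 s * f i s = 0) \<and>
             (4 \<le> m \<longrightarrow>
               vector_derivative (f m) (at s within I) + \<kappa> (m - 1) s * f (m - 1) s
                 + \<rho> (\<gamma> s) * f 1 s * f m s = 0)))"
proof -
  interpret curve_in_manifold m M A g D I \<gamma>
    using assms(1,4,5,9) unfolding frenet_curve_def by unfold_locales auto
  have AT: "anti_torqued M A g D V \<rho>"
    by fact
  note frame = assms(11)[unfolded frenet_frame_def]
  have m: "2 \<le> m" and slant: "\<And>s. s \<in> I \<Longrightarrow> g (\<gamma> s) (V (\<gamma> s)) (N 2 s) = cos \<theta>"
    using assms(14) unfolding slant_helix_def by auto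
  have N: "smooth_field_along A I \<gamma> (N i)" if "i \<in> {1..m}" for i
    using frame that by blast
  have N1: "N 1 s = tangent_field A I \<gamma> s" if "s \<in> I" for s
    using frame that by blast
  have on: "g (\<gamma> s) (N i s) (N j s) = (if i = j then 1 else 0)"
    if "s \<in> I" "i \<in> {1..m}" "j \<in> {1..m}" for s i j
    using frame that by blast
  have cov1: "cov_deriv A D I \<gamma> (N 1) s = \<kappa> 1 s *\<^sub>R N 2 s" if "s \<in> I" for s
    using frame m that by blast
  have covi: "cov_deriv A D I \<gamma> (N i) s = - \<kappa> (i - 1) s *\<^sub>R N (i - 1) s + \<kappa> i s *\<^sub>R N (i + 1) s"
    if "s \<in> I" "2 \<le> i" "i \<le> m - 1" for s i
    using frame that by blast
  have covm: "cov_deriv A D I \<gamma> (N m) s = - \<kappa> (m - 1) s *\<^sub>R N (m - 1) s" if "s \<in> I" for s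
    using frame m that by blast
  have V: "vector_field_on A (topspace M) V"
    using AT unfolding anti_torqued_def by blast
  note Vs = field_along_restrict[OF V]
  have tN: "N i s \<in> tangent_space A (\<gamma> s)" if "s \<in> I" "i \<in> {1..m}" for s i
    using field_along_tangent[OF N[OF that(2)] that(1)] .
  have tV: "V (\<gamma> s) \<in> tangent_space A (\<gamma> s)" if "s \<in> I" for s
    using field_along_tangent[OF Vs that] .
  define f where "f i s = (if i \<in> {1..m} then g (\<gamma> s) (V (\<gamma> s)) (N i s) else 0)" for i s
  have f2: "f 2 s = cos \<theta>" if "s \<in> I" for s
    using slant[OF that] m by (simp add: f_def)
  have fm: "f j s = 0" if "m < j" for j s
    using that by (simp add: f_def)
  have fsmooth: "smooth_on I (f i)" if "i \<in> {1..m}" for i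
    using metric_along_smooth[OF Vs N[OF that]] that by (simp add: f_def[abs_def])
  have gV: "g (\<gamma> s) (V (\<gamma> s)) (a *\<^sub>R N i s + b *\<^sub>R N j s) = a * f i s + b * f j s"
    if "s \<in> I" "i \<in> {1..m}" "j \<in> {1..m}" for s a b i j
  proof -
    note p = curve_in_M[OF that(1)]
    have "g (\<gamma> s) (V (\<gamma> s)) (a *\<^sub>R N i s + b *\<^sub>R N j s) = g (\<gamma> s) (a *\<^sub>R N i s + b *\<^sub>R N j s) (V (\<gamma> s))"
      using that by (intro metric_sym p tV tangent_add tangent_scaleR tN)
    also have "\<dots> = a * g (\<gamma> s) (N i s) (V (\<gamma> s)) + b * g (\<gamma> s) (N j s) (V (\<gamma> s))"
      using that by (simp add: metric_add metric_scaleR p tV tangent_scaleR tN)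
    also have "\<dots> = a * f i s + b * f j s"
      using that metric_sym[OF p tV[OF that(1)] tN[OF that(1)]] by (simp add: f_def)
    finally show ?thesis .
  qed
  \<comment> \<open>The Frenet equations; the first and the last frame vector have one neighbour only.\<close>
  have covN: "cov_deriv A D I \<gamma> (N i) s \<in> tangent_space A (\<gamma> s) \<and>
      g (\<gamma> s) (V (\<gamma> s)) (cov_deriv A D I \<gamma> (N i) s)
        = (if i = 1 then 0 else - \<kappa> (i - 1) s * f (i - 1) s)
          + (if i = m then 0 else \<kappa> i s * f (i + 1) s)"
    if s: "s \<in> I" and i: "i \<in> {1..m}" for i s
  proof -
    consider "i = 1" | "2 \<le> i" "i \<le> m - 1" | "i = m" "i \<noteq> 1"
      using i by force
    then show ?thesis
    proof cases
      case 1
      then show ?thesis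
        using gV[OF s, of 2 2 "\<kappa> 1 s" 0] cov1[OF s] m tN[OF s, of 2] tangent_scaleR
        by (simp add: numeral_2_eq_2)
    next
      case 2
      have j: "i - 1 \<in> {1..m}" "i + 1 \<in> {1..m}" and ne: "i \<noteq> 1" "i \<noteq> m"
        using 2 m by auto
      show ?thesis
        unfolding covi[OF s 2]
        using ne gV[OF s j, of "- \<kappa> (i - 1) s" "\<kappa> i s"]
          tangent_add[OF tangent_scaleR[OF tN[OF s j(1)]] tangent_scaleR[OF tN[OF s j(2)]]]
        by (simp only: if_False simp_thms)
    next
      case 3
      have j: "m - 1 \<in> {1..m}"
        using m by auto
      show ?thesis
        using 3 gV[OF s j j, of "- \<kappa> (m - 1) s" 0] covm[OF s]
          tangent_scaleR[OF tN[OF s j], of "- \<kappa> (m - 1) s"]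
        by simp
    qed
  qed
  have deriv: "vector_derivative (f i) (at s within I)
      = \<rho> (\<gamma> s) * ((if i = 1 then 1 else 0) - f 1 s * f i s)
        + ((if i = 1 then 0 else - \<kappa> (i - 1) s * f (i - 1) s)
          + (if i = m then 0 else \<kappa> i s * f (i + 1) s))"
    if s: "s \<in> I" and i: "i \<in> {1..m}" for i s
  proof (rule vector_derivative_within[OF at_within_axis_dense_ne_bot[OF interval_axis_dense s]])
    have one: "1 \<in> {1..m}"
      using m by simp
    have fv: "g (\<gamma> t) (V (\<gamma> t)) (N i t) = f i t" for t
      using i by (simp add: f_def)
    have f1: "g (\<gamma> s) (V (\<gamma> s)) (tangent_field A I \<gamma> s) = f 1 s"
      using one N1[OF s] by (simp add: f_def)
    have Ti: "g (\<gamma> s) (tangent_field A I \<gamma> s) (N i s) = (if i = 1 then 1 else 0)"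
      using on[OF s one i] N1[OF s] by (simp add: eq_commute)
    have "tangent_field A I \<gamma> s \<in> tangent_space A (\<gamma> s)"
      using tN[OF s one] N1[OF s] by simp
    from anti_torqued_component_derivative[OF AT s this N[OF i] conjunct1[OF covN[OF s i]]]
    show "(f i has_vector_derivative
      \<rho> (\<gamma> s) * ((if i = 1 then 1 else 0) - f 1 s * f i s)
        + ((if i = 1 then 0 else - \<kappa> (i - 1) s * f (i - 1) s)
          + (if i = m then 0 else \<kappa> i s * f (i + 1) s))) (at s within I)"
      unfolding Ti f1 conjunct2[OF covN[OF s i]] fv .
  qed
  \<comment> \<open>For \<open>m = 2\<close> the term with \<open>\<kappa> 2\<close> disappears because \<open>f 3\<close> is zero.\<close>
  have second: "\<kappa> 1 s * f 1 s - \<kappa> 2 s * f 3 s + cos \<theta> * \<rho> (\<gamma> s) * f 1 s = 0" if s: "s \<in> I" for s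
  proof -
    have "((\<lambda>_. cos \<theta>) has_vector_derivative 0) (at s within I)"
      by simp
    then have "(f 2 has_vector_derivative 0) (at s within I)"
      by (rule has_vector_derivative_transform[OF s, rotated]) (use f2 in simp)
    then have "vector_derivative (f 2) (at s within I) = 0"
      by (rule vector_derivative_within[OF at_within_axis_dense_ne_bot[OF interval_axis_dense s]])
    then show ?thesis
      using deriv[OF s, of 2] m f2[OF s] fm[of 3 s]
      by (cases "m = 2") (simp_all add: algebra_simps numeral_3_eq_3 numeral_2_eq_2)
  qed
  have expansion: "V (\<gamma> s) = f 1 s *\<^sub>R N 1 s + cos \<theta> *\<^sub>R N 2 s + (\<Sum>i=3..m. f i s *\<^sub>R N i s)"
    if s: "s \<in> I" for s
  proof -
    have "V (\<gamma> s) = (\<Sum>i=1..m. g (\<gamma> s) (V (\<gamma> s)) (N i s) *\<^sub>R N i s)"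
      using orthonormal_expansion[OF curve_in_M[OF s], of "\<lambda>i. N i s"] tN[OF s] on[OF s] tV[OF s]
      by blast
    also have "\<dots> = (\<Sum>i=1..m. f i s *\<^sub>R N i s)"
      by (intro sum.cong) (auto simp: f_def)
    also have "{1..m} = {1} \<union> {2} \<union> {3..m}"
      using m by auto
    also have "(\<Sum>i\<in>\<dots>. f i s *\<^sub>R N i s) = f 1 s *\<^sub>R N 1 s + f 2 s *\<^sub>R N 2 s + (\<Sum>i=3..m. f i s *\<^sub>R N i s)"
      by (simp add: add.assoc)
    finally show ?thesis
      using f2[OF s] by simp
  qed
  have "vector_derivative (f 1) (at s within I) - cos \<theta> * \<kappa> 1 s - \<rho> (\<gamma> s) * (1 - (f 1 s)\<^sup>2) = 0"
    if "s \<in> I" for s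
    using deriv[OF that, of 1] m f2[OF that]
    by (simp add: power2_eq_square numeral_2_eq_2)
  moreover have "vector_derivative (f 3) (at s within I) + cos \<theta> * \<kappa> 2 s - \<kappa> 3 s * f 4 s
                 + \<rho> (\<gamma> s) * f 1 s * f 3 s = 0" if "s \<in> I" "3 \<le> m" for s
    using deriv[OF that(1), of 3] that f2[OF that(1)] fm[of 4 s] by (cases "m = 3") simp_all
  moreover have "vector_derivative (f i) (at s within I) + \<kappa> (i - 1) s * f (i - 1) s
                 - \<kappa> i s * f (i + 1) s + \<rho> (\<gamma> s) * f 1 s * f i s = 0"
    if "s \<in> I" "4 \<le> i" "i \<le> m - 1" for s i
    using deriv[OF that(1), of i] that by simp
  moreover have "vector_derivative (f m) (at s within I) + \<kappa> (m - 1) s * f (m - 1) s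
                 + \<rho> (\<gamma> s) * f 1 s * f m s = 0" if "s \<in> I" "4 \<le> m" for s
    using deriv[OF that(1), of m] that by simp
  moreover have "smooth_on I (f i)" if "i \<in> {1} \<union> {3..m}" for i
    using that m by (intro fsmooth) auto
  ultimately show ?thesis
    using second expansion fm by (intro disjI2 exI[of _ f]) blast
qed

end
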